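(* Let $q$ be an integral nonsingular ternary quadratic form with determinant $\det q=2\Delta$, and let $p$ be a prime not dividing $2\Delta$. Fix a complete system $\{q_1,\dots,q_h\}$ of representatives of the distinct integral equivalence classes of the similarity class of $q$, and a complete system $\{n_1,\dots,n_H\}$ of representatives of the distinct integral equivalence classes of the similarity class of $n$, where $n$ is the integral quaternary form defined by the norm on the even Clifford subalgebra of $q$. Then $$\sum_{i=1}^h \big|R^*(q,p^2q_i)/E(q_i)\big| = (1+\chi_p(n))^{-1}\sum_{i=1}^H\big|R(n,p\,n_i)/E(n_i)\big|,$$ where $\chi_p(n)=\left(\frac{(-1)^2\Delta^2}{p}\right)$ (Legendre symbol).
   Context: For integral quadratic forms $f,f'$ in $m$ variables with (even symmetric) matrices $F,F'$ ($2f(X)={}^tXFX$), $R(f,f')=\{A\in\mathbb Z^m_m:{}^tAFA=F'\}$, $R^*(f,f')$ is the subset of matrices whose entries have gcd $1$, $E(f)=R(f,f)\cap GL_m(\mathbb Z)$, and $R(f,f')/E(f')$ is the (finite) set of right cosets $AE(f')$. $af$ is the form with matrix $aF$. $f'$ is integrally equivalent to $f$ if $f'=f[U]$, $U\in GL_m(\mathbb Z)$; $f'$ is similar to $f$ if they have the same number of variables, equal determinants ($\det f=\det F$) and $R(f,af')\ne\emptyset$ for some $a$ coprime to $\det f$. For $q(X)=q_1x_1^2+b_{12}x_1x_2+b_{13}x_1x_3+q_2x_2^2+b_{23}x_2x_3+q_3x_3^2$, set $Q_0=\begin{pmatrix}q_1&b_{12}&b_{13}\\0&q_2&b_{23}\\0&0&q_3\end{pmatrix}$,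 $B={}^t(-b_{23},b_{13},-b_{12})$; $n$ is the quaternary form with matrix $N=\begin{pmatrix}2&-{}^tB\\-B&{}^t\tilde Q_0+\tilde Q_0\end{pmatrix}$ ($\tilde Y$ = adjugate), i.e. the norm $x\bar x$ on $C_0(\mathbb Z^3,q)$ in the basis $e_0,e_2e_3,-e_1e_3,e_1e_2$. *)

theory Defs
  imports "HOL-Analysis.Analysis" "HOL-Number_Theory.Residues"
begin

text \<open>
  An integral quadratic form \<open>f\<close> in \<open>m\<close> variables is identified with its matrix \<open>F\<close>, the even
  symmetric integral matrix with \<open>2 f(X) = X\<^sup>T F X\<close>; this is a bijection between forms with
  integral coefficients and even symmetric matrices.  In particular \<open>det f\<close> is \<open>det F\<close>.
\<close>

definition integral_form :: "int^'m^'m \<Rightarrow> bool"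
  where "integral_form F \<longleftrightarrow> transpose F = F \<and> (\<forall>i. even (F $ i $ i))"

text \<open>The matrix of \<open>a f\<close>.\<close>

abbreviation scale_form :: "int \<Rightarrow> int^'m^'m \<Rightarrow> int^'m^'m"
  where "scale_form a F \<equiv> map_matrix ((*) a) F"

text \<open>\<open>R(f,f')\<close>, \<open>R\<^sup>*(f,f')\<close> and \<open>E(f)\<close>.\<close>

definition reps :: "int^'m^'m \<Rightarrow> int^'m^'m \<Rightarrow> (int^'m^'m) set"
  where "reps F F' = {A. transpose A ** F ** A = F'}"

definition prim_reps :: "int^'m^'m \<Rightarrow> int^'m^'m \<Rightarrow> (int^'m^'m) set"
  where "prim_reps F F' = {A \<in> reps F F'. Gcd {A $ i $ j |i j. True} = 1}"

text \<open>
  Over \<open>int\<close>, \<^const>\<open>invertible\<close> asks for an inverse with integral entries, so it describes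
  membership in \<open>GL\<^sub>m(Z)\<close>.
\<close>

definition automorphs :: "int^'m^'m \<Rightarrow> (int^'m^'m) set"
  where "automorphs F = {U \<in> reps F F. invertible U}"

text \<open>The set of cosets \<open>A E(f')\<close> with \<open>A \<in> S\<close>, where \<open>F'\<close> is the matrix of \<open>f'\<close>.\<close>

definition cosets_mod_automorphs :: "(int^'m^'m) set \<Rightarrow> int^'m^'m \<Rightarrow> (int^'m^'m) set set"
  where "cosets_mod_automorphs S F' = (\<lambda>A. (\<lambda>U. A ** U) ` automorphs F') ` S"

definition int_equivalent :: "int^'m^'m \<Rightarrow> int^'m^'m \<Rightarrow> bool"
  where "int_equivalent F F' \<longleftrightarrow> (\<exists>U. invertible U \<and> F' = transpose U ** F ** U)"

text \<open>
  The condition \<open>a \<noteq> 0\<close> only matters for \<open>det F = \<plusminus>1\<close>, where \<open>0\<close> would count as coprime to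
  \<open>det F\<close> and the zero matrix would lie in \<open>R(f, 0 f')\<close>.
\<close>

definition similarity_class :: "int^'m^'m \<Rightarrow> (int^'m^'m) set"
  where "similarity_class F =
    {F'. integral_form F' \<and> det F' = det F \<and>
         (\<exists>a. a \<noteq> 0 \<and> coprime a (det F) \<and> reps F (scale_form a F') \<noteq> {})}"

text \<open>
  \<open>r 1, \<dots>, r h\<close> are representatives of the distinct integral equivalence classes
  contained in the set \<open>C\<close> of forms.
\<close>

definition complete_system :: "(int^'m^'m) set \<Rightarrow> nat \<Rightarrow> (nat \<Rightarrow> int^'m^'m) \<Rightarrow> bool"
  where "complete_system C h r \<longleftrightarrow>
    (\<forall>i\<in>{1..h}. r i \<in> C) \<and>
    (\<forall>G\<in>C. \<exists>!i. i \<in> {1..h} \<and> int_equivalent (r i) G)"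

definition adjugate :: "'a::comm_ring_1^'m^'m \<Rightarrow> 'a^'m^'m"
  where "adjugate A =
    (\<chi> i j. det (\<chi> k. if k = j then axis i 1 else row k A))"

text \<open>
  The upper triangular matrix \<open>Q\<^sub>0\<close> of the coefficients of the ternary form
  \<open>q(X) = q\<^sub>1 x\<^sub>1\<^sup>2 + b\<^sub>1\<^sub>2 x\<^sub>1 x\<^sub>2 + b\<^sub>1\<^sub>3 x\<^sub>1 x\<^sub>3 + q\<^sub>2 x\<^sub>2\<^sup>2 + b\<^sub>2\<^sub>3 x\<^sub>2 x\<^sub>3 + q\<^sub>3 x\<^sub>3\<^sup>2\<close> with matrix \<open>Q\<close>,
  whose diagonal is \<open>2 q\<^sub>1, 2 q\<^sub>2, 2 q\<^sub>3\<close>.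
\<close>

definition upper_matrix :: "int^3^3 \<Rightarrow> int^3^3"
  where "upper_matrix Q = vector
    [vector [Q$1$1 div 2, Q$1$2,       Q$1$3],
     vector [0,           Q$2$2 div 2, Q$2$3],
     vector [0,           0,           Q$3$3 div 2]]"

text \<open>
  The matrix \<open>N\<close> of the norm form of the even Clifford algebra of \<open>q\<close> in the basis
  \<open>e\<^sub>0 = 1, e\<^sub>2 e\<^sub>3, - e\<^sub>1 e\<^sub>3, e\<^sub>1 e\<^sub>2\<close>; see the lemma \<open>clifford_norm\<close> below.
\<close>

definition clifford_norm_form :: "int^3^3 \<Rightarrow> int^4^4"
  where "clifford_norm_form Q =
    (let Q0 = upper_matrix Q;
         B = (vector [- Q0$2$3, Q0$1$3, - Q0$1$2] :: int^3);
         M = transpose (adjugate Q0) + adjugate Q0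
     in vector
       [vector [2,      - B$1,   - B$2,   - B$3],
        vector [- B$1,  M$1$1,   M$1$2,   M$1$3],
        vector [- B$2,  M$2$1,   M$2$2,   M$2$3],
        vector [- B$3,  M$3$1,   M$3$2,   M$3$3]])"

lemma vector_4 [simp]:
  "(vector [w,x,y,z] :: 'a::zero^4) $ 1 = w"
  "(vector [w,x,y,z] :: 'a::zero^4) $ 2 = x"
  "(vector [w,x,y,z] :: 'a::zero^4) $ 3 = y"
  "(vector [w,x,y,z] :: 'a::zero^4) $ 4 = z"
  unfolding vector_def by simp_all

lemma upper_matrix_sum:
  assumes "integral_form Q"
  shows "Q = transpose (upper_matrix Q) + upper_matrix Q"
proof -
  have "transpose Q $ i $ j = Q $ i $ j" for i j
    using assms by (simp add: integral_form_def)
  then have sym: "Q $ j $ i = Q $ i $ j" for i j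
    by (simp add: transpose_def)
  have ev: "2 * (Q $ i $ i div 2) = Q $ i $ i" for i
    using assms by (simp add: integral_form_def)
  show ?thesis
    using sym[of 1 2] sym[of 1 3] sym[of 2 3] ev[of 1] ev[of 2] ev[of 3]
    by (simp add: vec_eq_iff forall_3 upper_matrix_def transpose_def)
qed

lemma adjugate_upper:
  fixes a b c d e f :: "'a::comm_ring_1"
  shows "adjugate (vector [vector [a, b, c], vector [0, d, e], vector [0, 0, f]] :: 'a^3^3) =
    vector [vector [d * f, - (b * f), b * e - c * d], vector [0, a * f, - (a * e)],
            vector [0, 0, a * d]]"
  by (simp add: vec_eq_iff forall_3 adjugate_def det_3 axis_def row_def)

lemma adjugate_mult_3:
  fixes A :: "'a::comm_ring_1^3^3"
  shows "A ** adjugate A = mat (det A)"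
  by (simp add: vec_eq_iff forall_3 adjugate_def det_3 axis_def row_def
      matrix_matrix_mult_def sum_3 mat_def algebra_simps)

lemma integral_form_clifford_norm_form: "integral_form (clifford_norm_form Q)"
  by (simp add: integral_form_def clifford_norm_form_def Let_def vec_eq_iff forall_4
      transpose_def)

text \<open>
  If \<open>e\<^sub>1, e\<^sub>2, e\<^sub>3\<close> satisfy the relations of the Clifford algebra of \<open>q\<close> and \<open>x\<close> is an
  integral combination of the above basis, with conjugate \<open>x'\<close> (which reverses products of the
  generators), then the matrix above describes \<open>2 x x'\<close>.
\<close>

lemma clifford_norm:
  fixes e1 e2 e3 :: "'a::ring_1" and X :: "int^4"
  assumes "integral_form Q"
    and "e1 * e1 = of_int (Q$1$1 div 2)" "e2 * e2 = of_int (Q$2$2 div 2)"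
      "e3 * e3 = of_int (Q$3$3 div 2)"
    and "e1 * e2 + e2 * e1 = of_int (Q$1$2)" "e1 * e3 + e3 * e1 = of_int (Q$1$3)"
      "e2 * e3 + e3 * e2 = of_int (Q$2$3)"
    and "x = of_int (X$1) + of_int (X$2) * (e2 * e3) - of_int (X$3) * (e1 * e3)
               + of_int (X$4) * (e1 * e2)"
    and "x' = of_int (X$1) + of_int (X$2) * (e3 * e2) - of_int (X$3) * (e3 * e1)
               + of_int (X$4) * (e2 * e1)"
  shows "2 * (x * x') = of_int (\<Sum>i\<in>UNIV. X$i * (clifford_norm_form Q *v X)$i)"
proof -
  define a b c where "a = Q$1$1 div 2" and "b = Q$2$2 div 2" and "c = Q$3$3 div 2"
  define u v w where "u = Q$1$2" and "v = Q$1$3" and "w = Q$2$3"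
  define y0 y1 y2 y3 where "y0 = X$1" and "y1 = X$2" and "y2 = X$3" and "y3 = X$4"
  have N: "clifford_norm_form Q = vector
     [vector [2, w, - v, u],
      vector [w, 2 * (b * c), - (u * c), u * w - v * b],
      vector [- v, - (u * c), 2 * (a * c), - (a * w)],
      vector [u, u * w - v * b, - (a * w), 2 * (a * b)]]"
    by (simp add: clifford_norm_form_def Let_def upper_matrix_def adjugate_upper
        a_def b_def c_def u_def v_def w_def transpose_def vec_eq_iff forall_4)
  have sq: "e1 * e1 = of_int a" "e2 * e2 = of_int b" "e3 * e3 = of_int c"
    using assms by (simp_all add: a_def b_def c_def)
  have sw: "e2 * e1 = of_int u - e1 * e2" "e3 * e1 = of_int v - e1 * e3"
      "e3 * e2 = of_int w - e2 * e3"
    using assms by (simp_all add: u_def v_def w_def eq_diff_eq add.commute)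
  have sq': "e1 * (e1 * z) = of_int a * z" "e2 * (e2 * z) = of_int b * z"
      "e3 * (e3 * z) = of_int c * z" for z
    by (simp_all flip: mult.assoc add: sq)
  have sw': "e2 * (e1 * z) = of_int u * z - e1 * (e2 * z)"
      "e3 * (e1 * z) = of_int v * z - e1 * (e3 * z)"
      "e3 * (e2 * z) = of_int w * z - e2 * (e3 * z)" for z
    by (simp_all flip: mult.assoc add: sw left_diff_distrib)
  have cm: "e1 * of_int k = of_int k * e1" "e2 * of_int k = of_int k * e2"
      "e3 * of_int k = of_int k * e3" for k
    by (simp_all add: mult_of_int_commute)
  have cm': "e1 * (of_int k * z) = of_int k * (e1 * z)" "e2 * (of_int k * z) = of_int k * (e2 * z)"
      "e3 * (of_int k * z) = of_int k * (e3 * z)" for k z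
    by (simp_all flip: mult.assoc add: cm)
  have cc: "(of_int k :: 'a) * of_int l = of_int l * of_int k" for k l
    by (rule mult_of_int_commute)
  have cc': "(of_int k :: 'a) * (of_int l * z) = of_int l * (of_int k * z)" for k l z
    by (metis mult.assoc mult_of_int_commute)
  have "x * x' = of_int (y0\<^sup>2 + y0 * y1 * w - y0 * y2 * v + y0 * y3 * u + y1\<^sup>2 * b * c
      + y2\<^sup>2 * a * c + y3\<^sup>2 * a * b - y1 * y2 * u * c + y1 * y3 * (u * w - v * b) - y2 * y3 * a * w)"
    unfolding assms(8,9) y0_def[symmetric] y1_def[symmetric] y2_def[symmetric] y3_def[symmetric]
    by (simp add: power2_eq_square distrib_left distrib_right left_diff_distrib right_diff_distrib
        mult.assoc sq sw sq' sw' cm cm' cc cc')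
  moreover have "(\<Sum>i\<in>UNIV. X$i * (clifford_norm_form Q *v X)$i) =
      2 * (y0\<^sup>2 + y0 * y1 * w - y0 * y2 * v + y0 * y3 * u + y1\<^sup>2 * b * c
      + y2\<^sup>2 * a * c + y3\<^sup>2 * a * b - y1 * y2 * u * c + y1 * y3 * (u * w - v * b) - y2 * y3 * a * w)"
    unfolding N by (simp add: sum_4 matrix_vector_mult_def y0_def y1_def y2_def y3_def
        algebra_simps power2_eq_square)
  ultimately show ?thesis by simp
qed

end

theory Submission
  imports Defs
begin

text \<open>
  A coset \<open>A E(f')\<close> with \<open>A \<in> R(f, k f')\<close> is the same thing as the lattice \<open>L = A Z\<^sup>m\<close>, and \<open>f'\<close> is
  determined up to equivalence by \<open>L\<close>. Hence, for \<open>k\<close> odd and coprime to \<open>det f\<close>, a sum over a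
  similarity class counts the lattices \<open>L \<subseteq> Z\<^sup>m\<close> of index \<open>k\<^bsup>m/2\<^esup>\<close> on which the bilinear form of \<open>f\<close>
  is divisible by \<open>k\<close>. Such lattices are equal to their own dual modulo \<open>k\<close>.

  As \<open>p\<close> is odd and prime to the determinants, \<open>2 q\<close> is equivalent to \<open>2 a x\<^sub>1 x\<^sub>3 + b x\<^sub>2\<^sup>2\<close> modulo
  \<open>p\<^sup>2\<close>, and \<open>2 n\<close>, whose determinant is the square \<open>\<Delta>\<^sup>2\<close>, is equivalent to
  \<open>2 a x\<^sub>1 x\<^sub>4 + 2 b x\<^sub>2 x\<^sub>3\<close> modulo \<open>p\<close>. The primitive lattices on the left correspond to the \<open>p + 1\<close>
  points of a conic, those on the right to the \<open>2 (p + 1)\<close> lines on a split quadric surface, and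
  \<open>1 + \<chi>\<^sub>p(n) = 2\<close>.
\<close>

section \<open>Integral matrices and their column lattices\<close>

text \<open>Self-duality keeps the classification short. Passing to the dual reverses inclusions, so
  comparable self-dual lattices coincide; it is enough to trap a given lattice inside one member of
  an explicit list. The two sides need different precision. The multiplier \<open>p^2\<close> calls
  for a normal form modulo \<open>p^2\<close>, reached from one modulo \<open>p\<close> by a Hensel
  step, while the multiplier \<open>p\<close> only sees the form modulo \<open>p\<close>.
  Primitivity on the left removes exactly one lattice, \<open>p Z^3\<close>, which is self-dual
  modulo \<open>p^2\<close> for every ternary form that is nonsingular modulo \<open>p\<close>. On
  the right, the square determinant forces the plane that remains after splitting off a hyperbolic
  plane to be hyperbolic as well; with a non-square determinant the quadric would contain no line
  over the field with \<open>p\<close> elements. The normal form is only congruent to a form in the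
  integral class, not equal to one. Hence the count is first carried along a unimodular change of
  basis, and then every divisibility is read off from the normal form modulo \<open>p\<close> or
  \<open>p^2\<close>.\<close>

lemma det_4:
  fixes A :: "'a::comm_ring_1^4^4"
  shows "det A =
    A$1$1 * (A$2$2 * (A$3$3 * A$4$4 - A$3$4 * A$4$3) - A$2$3 * (A$3$2 * A$4$4 - A$3$4 * A$4$2)
      + A$2$4 * (A$3$2 * A$4$3 - A$3$3 * A$4$2))
    - A$1$2 * (A$2$1 * (A$3$3 * A$4$4 - A$3$4 * A$4$3) - A$2$3 * (A$3$1 * A$4$4 - A$3$4 * A$4$1)
      + A$2$4 * (A$3$1 * A$4$3 - A$3$3 * A$4$1))
    + A$1$3 * (A$2$1 * (A$3$2 * A$4$4 - A$3$4 * A$4$2) - A$2$2 * (A$3$1 * A$4$4 - A$3$4 * A$4$1)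
      + A$2$4 * (A$3$1 * A$4$2 - A$3$2 * A$4$1))
    - A$1$4 * (A$2$1 * (A$3$2 * A$4$3 - A$3$3 * A$4$2) - A$2$2 * (A$3$1 * A$4$3 - A$3$3 * A$4$1)
      + A$2$3 * (A$3$1 * A$4$2 - A$3$2 * A$4$1))"
proof -
  have f: "finite {2::4, 3, 4}" "1 \<notin> {2::4, 3, 4}" "finite {3::4, 4}" "2 \<notin> {3::4, 4}"
    "finite {4::4}" "3 \<notin> {4::4}"
    by auto
  show ?thesis
    unfolding det_def UNIV_4
    unfolding sum_over_permutations_insert[OF f(1,2)]
    unfolding sum_over_permutations_insert[OF f(3,4)]
    unfolding sum_over_permutations_insert[OF f(5,6)]
    unfolding permutes_sing
    by (simp add: sign_swap_id permutation_swap_id permutation_compose sign_compose sign_id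
        swap_id_eq algebra_simps)
qed

lemma det_cong:
  fixes A B :: "int^'m^'m"
  assumes "\<And>i j. [A $ i $ j = B $ i $ j] (mod k)"
  shows "[det A = det B] (mod k)"
  unfolding det_def by (intro cong_sum cong_mult cong_prod cong_refl assms)

text \<open>Modulo \<open>k\<close> the row may be replaced by zero.\<close>

lemma dvd_det_row:
  fixes A :: "int^'m^'m"
  assumes "\<And>j. k dvd A $ i $ j"
  shows "k dvd det A"
proof -
  have "[det A = det (\<chi> l. if l = i then 0 else A $ l)] (mod k)"
    using assms by (intro det_cong) (simp add: cong_0_iff)
  then show ?thesis by (simp add: det_row_0 cong_0_iff)
qed

lemma det_mat: "det (mat c :: 'a::comm_ring_1^'m^'m) = c ^ CARD('m)"
  by (subst det_diagonal) (simp_all add: mat_def)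

lemma mat_mult_left: "mat c ** A = map_matrix ((*) c) (A :: 'a::comm_ring_1^'n^'m)"
  by (simp add: vec_eq_iff matrix_matrix_mult_def mat_def if_distrib[of "\<lambda>x. x * _"] cong: if_cong)

lemma mat_mult_right: "A ** mat c = map_matrix ((*) c) (A :: 'a::comm_ring_1^'n^'m)"
  by (simp add: vec_eq_iff matrix_matrix_mult_def mat_def if_distrib[of "\<lambda>x. _ * x"] mult.commute
      cong: if_cong)

lemma mat_mult_vec: "mat c *v x = c *s (x :: 'a::comm_ring_1^'m)"
  by (simp add: vec_eq_iff matrix_vector_mult_def mat_def if_distrib[of "\<lambda>x. x * _"] cong: if_cong)

lemma det_scale: "det (map_matrix ((*) c) A) = c ^ CARD('m) * det (A :: 'a::comm_ring_1^'m^'m)"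
  by (simp flip: mat_mult_left add: det_mul det_mat)

lemma map_matrix_mult_left:
  "map_matrix ((*) c) A ** B = map_matrix ((*) c) (A ** (B :: 'a::comm_ring_1^'n^'m))"
  by (simp flip: mat_mult_left add: matrix_mul_assoc)

lemma map_matrix_mult_right:
  "A ** map_matrix ((*) c) B = map_matrix ((*) c) (A ** (B :: 'a::comm_ring_1^'n^'m))"
  by (simp flip: mat_mult_right add: matrix_mul_assoc)

text \<open>By linearity in row \<open>j\<close>, entry \<open>(k, j)\<close> of the product is the
  determinant of \<open>A\<close> with row \<open>j\<close> replaced by row \<open>k\<close>; two
  rows coincide unless \<open>k = j\<close>.\<close>

lemma mult_adjugate:
  fixes A :: "'a::comm_ring_1^'m^'m"
  shows "A ** adjugate A = mat (det A)"
proof -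
  have "(A ** adjugate A) $ k $ j = mat (det A) $ k $ j" for k j
  proof -
    have r: "row k A = (\<Sum>i\<in>UNIV. (A $ k $ i) *s axis i 1)"
      by (simp add: vec_eq_iff row_def axis_def if_distrib cong: if_cong)
    have "(A ** adjugate A) $ k $ j
        = (\<Sum>i\<in>UNIV. A $ k $ i * det (\<chi> l. if l = j then axis i 1 else row l A))"
      by (simp add: matrix_matrix_mult_def adjugate_def)
    also have "\<dots> = det (\<chi> l. if l = j then row k A else row l A)"
      unfolding r by (subst det_linear_row_sum) (simp_all add: det_row_mul)
    also have "\<dots> = mat (det A) $ k $ j"
    proof (cases "k = j")
      case True
      have "(\<chi> l. if l = j then row k A else row l A) = A"
        using True by (simp add: vec_eq_iff row_def)
      then show ?thesis using True by (simp add: mat_def)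
    next
      case False
      have "det (\<chi> l. if l = j then row k A else row l A) = 0"
        by (rule det_identical_rows[OF False]) (use False in \<open>simp add: row_def\<close>)
      then show ?thesis using False by (simp add: mat_def)
    qed
    finally show ?thesis .
  qed
  then show ?thesis by (simp add: vec_eq_iff)
qed

text \<open>A substitute for the inverse that stays integral. Transposing gives a left adjugate
  \<open>L\<close>; evaluating \<open>L ** A ** adjugate A\<close> in two ways and cancelling the
  determinant identifies it with the right one.\<close>

lemma ex_adjugate:
  fixes A :: "int^'m^'m"
  assumes "det A \<noteq> 0"
  obtains B where "A ** B = mat (det A)" "B ** A = mat (det A)"
proof -
  define L where "L = transpose (adjugate (transpose A))"
  have L: "L ** A = mat (det A)"
    using arg_cong[OF mult_adjugate[of "transpose A"], of transpose]
    by (simp add: L_def matrix_transpose_mul)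
  have "map_matrix ((*) (det A)) (adjugate A) = (L ** A) ** adjugate A"
    by (simp add: L mat_mult_left)
  also have "\<dots> = map_matrix ((*) (det A)) L"
    by (simp flip: matrix_mul_assoc add: mult_adjugate mat_mult_right)
  finally have "adjugate A = L"
    using assms by (simp add: vec_eq_iff)
  then show thesis using that mult_adjugate L by metis
qed

lemma matrix_mult_left_cancel:
  fixes A :: "int^'m^'m"
  assumes "det A \<noteq> 0" "A ** X = A ** Y"
  shows "X = Y"
proof -
  obtain B where B: "B ** A = mat (det A)"
    using ex_adjugate[OF assms(1)] by blast
  have "mat (det A) ** X = mat (det A) ** Y"
    using arg_cong[OF assms(2), of "(**) B"] by (simp add: matrix_mul_assoc B)
  then show ?thesis using assms(1) by (simp add: mat_mult_left vec_eq_iff)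
qed

text \<open>A determinant with square \<open>1\<close> is its own inverse, so scaling the adjugate
  by it gives an integral inverse.\<close>

lemma invertible_if_det_square:
  fixes A :: "int^'m^'m"
  assumes "(det A)\<^sup>2 = 1"
  shows "invertible A"
proof -
  have d: "det A * det A = 1" using assms by (simp add: power2_eq_square)
  then have "det A \<noteq> 0" by auto
  then obtain B where B: "A ** B = mat (det A)" "B ** A = mat (det A)"
    using ex_adjugate by blast
  have "A ** (mat (det A) ** B) = mat 1"
    by (simp add: mat_mult_left map_matrix_mult_right B) (simp add: d vec_eq_iff mat_def)
  moreover have "(mat (det A) ** B) ** A = mat 1"
    by (simp add: mat_mult_left map_matrix_mult_left B) (simp add: d vec_eq_iff mat_def)
  ultimately show ?thesis unfolding invertible_def by blast
qed

lemma det_square_invertible: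
  fixes A :: "int^'m^'m"
  assumes "invertible A"
  shows "(det A)\<^sup>2 = 1"
proof -
  obtain B where "A ** B = mat 1" using assms unfolding invertible_def by blast
  then have "det (A ** B) = 1" by (simp only: det_I)
  then have "det A * det B = 1" by (simp only: det_mul)
  then have "\<bar>det A\<bar> = 1" by (auto simp: zmult_eq_1_iff)
  then show ?thesis by (simp add: abs_square_eq_1)
qed

lemma mult_axis: "A *v axis j 1 = column j (A :: 'a::comm_ring_1^'n^'m)"
  by (simp add: vec_eq_iff matrix_vector_mult_def column_def axis_def if_distrib cong: if_cong)

text \<open>The columns of \<open>B\<close> are images of unit vectors; their preimages under
  \<open>A\<close> are the columns of \<open>C\<close>.\<close>

lemma range_mult_subset_iff:
  fixes A :: "int^'k^'m" and B :: "int^'n^'m"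
  shows "range ((*v) B) \<subseteq> range ((*v) A) \<longleftrightarrow> (\<exists>C. B = A ** C)"
proof
  assume *: "range ((*v) B) \<subseteq> range ((*v) A)"
  have "\<exists>y. A *v y = column j B" for j
  proof -
    have "column j B \<in> range ((*v) A)"
      using subsetD[OF * rangeI, of "axis j 1"] by (simp only: mult_axis)
    then show ?thesis by (elim rangeE) (rule exI, rule sym)
  qed
  then obtain c where c: "\<And>j. A *v c j = column j B" by metis
  have "B = A ** (\<chi> i j. c j $ i)"
    using c by (simp add: vec_eq_iff matrix_matrix_mult_def matrix_vector_mult_def column_def)
  then show "\<exists>C. B = A ** C" ..
next
  assume "\<exists>C. B = A ** C"
  then show "range ((*v) B) \<subseteq> range ((*v) A)"
    by (auto simp flip: matrix_vector_mul_assoc)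
qed

lemma range_mult_invertible:
  fixes A :: "int^'k^'m" and U :: "int^'n^'k"
  assumes "invertible U"
  shows "range ((*v) (A ** U)) = range ((*v) A)"
proof
  obtain V where V: "U ** V = mat 1" using assms unfolding invertible_def by blast
  show "range ((*v) (A ** U)) \<subseteq> range ((*v) A)"
    unfolding range_mult_subset_iff by (rule exI) (rule refl)
  have "A = (A ** U) ** V" by (simp flip: matrix_mul_assoc add: V)
  then show "range ((*v) A) \<subseteq> range ((*v) (A ** U))" 
    unfolding range_mult_subset_iff ..
qed

text \<open>Mutual inclusion gives \<open>A ** (U ** V) = A\<close>, and a nonzero determinant
  allows \<open>A\<close> to be cancelled.\<close>

lemma range_mult_eq_iff:
  fixes A B :: "int^'m^'m"
  assumes "det A \<noteq> 0"
  shows "range ((*v) B) = range ((*v) A) \<longleftrightarrow> (\<exists>U. invertible U \<and> B = A ** U)"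
proof
  assume *: "range ((*v) B) = range ((*v) A)"
  obtain U where U: "B = A ** U"
    using range_mult_subset_iff[of B A] * by auto
  obtain V where V: "A = B ** V"
    using range_mult_subset_iff[of A B] * by auto
  have "A ** (U ** V) = A ** mat 1"
    using V[unfolded U] by (simp only: matrix_mul_assoc matrix_mul_rid)
  then have "U ** V = mat 1" by (rule matrix_mult_left_cancel[OF assms])
  then have "det (U ** V) = 1" by (simp only: det_I)
  then have "det U * det V = 1" by (simp only: det_mul)
  then have "\<bar>det U\<bar> = 1" by (auto simp: zmult_eq_1_iff)
  then have "(det U)\<^sup>2 = 1" by (simp add: abs_square_eq_1)
  then show "\<exists>U. invertible U \<and> B = A ** U"
    by (intro exI[of _ U] conjI invertible_if_det_square U)
next
  assume "\<exists>U. invertible U \<and> B = A ** U"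
  then obtain U where "invertible U" and B: "B = A ** U" by (elim exE conjE)
  then show "range ((*v) B) = range ((*v) A)"
    unfolding B by (intro range_mult_invertible)
qed

section \<open>Self-dual sublattices\<close>

definition bilin :: "'a::comm_ring_1^'m^'m \<Rightarrow> 'a^'m \<Rightarrow> 'a^'m \<Rightarrow> 'a"
  where "bilin F x y = (\<Sum>i\<in>UNIV. \<Sum>j\<in>UNIV. x$i * F$i$j * y$j)"

lemma bilin_conv_sum: "bilin F x y = (\<Sum>i\<in>UNIV. x$i * (F *v y)$i)"
  by (simp add: bilin_def matrix_vector_mult_def sum_distrib_left mult.assoc)

lemma bilin_add_left: "bilin F (x + x') y = bilin F x y + bilin F x' y"
  by (simp add: bilin_def sum.distrib distrib_right)

lemma bilin_scale_left: "bilin F (c *s x) y = c * bilin F x y"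
  by (simp add: bilin_def sum_distrib_left mult_ac)

lemma bilin_commute: "transpose F = F \<Longrightarrow> bilin F x y = bilin F y x"
proof -
  assume "transpose F = F"
  then have "transpose F $ i $ j = F $ i $ j" for i j by simp
  then have "F $ i $ j = F $ j $ i" for i j by (simp add: transpose_def)
  then show ?thesis
    unfolding bilin_def by (subst sum.swap) (simp add: mult_ac)
qed

lemma bilin_mult: "bilin F (A *v x) y = (\<Sum>i\<in>UNIV. x$i * ((transpose A ** F) *v y)$i)"
proof -
  have "bilin F (A *v x) y = (\<Sum>i\<in>UNIV. \<Sum>j\<in>UNIV. x$j * (A$i$j * (F *v y)$i))"
    by (simp add: bilin_conv_sum matrix_vector_mult_def[of A] sum_distrib_right sum_distrib_left mult_ac)
  also have "\<dots> = (\<Sum>j\<in>UNIV. x$j * (transpose A *v (F *v y))$j)"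
    by (subst sum.swap) (simp add: vector_matrix_mult_def sum_distrib_left mult_ac)
  finally show ?thesis by (simp only: matrix_vector_mul_assoc)
qed

lemma bilin_mult_mult: "bilin F (A *v x) (A *v y) = bilin (transpose A ** F ** A) x y"
  unfolding bilin_mult unfolding bilin_conv_sum by (simp only: matrix_vector_mul_assoc)

lemma bilin_axis: "bilin F (axis i 1) (axis j 1) = F $ i $ j"
proof -
  have "bilin F (axis i 1) (axis j 1) = (\<Sum>k\<in>UNIV. if k = i then (F *v axis j 1) $ k else 0)"
    unfolding bilin_conv_sum by (intro sum.cong refl) (simp add: axis_def)
  then show ?thesis by (simp add: mult_axis column_def)
qed

lemma mult_vec_scale: "A *v (c *s x) = c *s (A *v x :: 'a::comm_ring_1^'m)"
  by (simp add: vec_eq_iff matrix_vector_mult_def sum_distrib_left mult_ac)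

text \<open>The equality encodes isotropy modulo \<open>k\<close> together with maximality. It also
  forces \<open>L\<close> to be closed under addition and scaling, so \<open>L\<close> can be an
  arbitrary set here.\<close>

definition self_dual :: "int \<Rightarrow> int^'m^'m \<Rightarrow> (int^'m) set \<Rightarrow> bool"
  where "self_dual k F L \<longleftrightarrow> L = {x. \<forall>y\<in>L. k dvd bilin F x y}"

text \<open>Squaring the determinant expresses index \<open>k^(m/2)\<close> without a half-integral
  exponent (\<open>m = 3\<close> on the ternary side) and without a sign.\<close>

definition sublattices :: "int \<Rightarrow> int^'m^'m \<Rightarrow> (int^'m) set set"
  where "sublattices k F = {range ((*v) A) |A. (det A)\<^sup>2 = k ^ CARD('m)
    \<and> (\<forall>i j. k dvd (transpose A ** F ** A) $ i $ j)}"

text \<open>Elements of \<open>M\<close> are orthogonal to \<open>M\<close>, hence to the smaller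
  \<open>L\<close>, hence lie in \<open>L\<close>.\<close>

lemma self_dual_subset_eq:
  assumes "self_dual k F L" "self_dual k F M" "L \<subseteq> M"
  shows "L = M"
  using assms unfolding self_dual_def by blast

lemma self_dual_dvd: "self_dual k F L \<Longrightarrow> x \<in> L \<Longrightarrow> y \<in> L \<Longrightarrow> k dvd bilin F x y"
  unfolding self_dual_def by blast

lemma self_dualI: "self_dual k F L \<Longrightarrow> (\<And>y. y \<in> L \<Longrightarrow> k dvd bilin F x y) \<Longrightarrow> x \<in> L"
  unfolding self_dual_def by blast

lemma self_dual_add: "self_dual k F L \<Longrightarrow> x \<in> L \<Longrightarrow> y \<in> L \<Longrightarrow> x + y \<in> L"
  by (rule self_dualI) (auto simp: bilin_add_left intro!: dvd_add self_dual_dvd)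

lemma self_dual_scale: "self_dual k F L \<Longrightarrow> x \<in> L \<Longrightarrow> c *s x \<in> L"
  by (rule self_dualI) (auto simp: bilin_scale_left intro!: dvd_mult self_dual_dvd)

lemma scaleE:
  fixes G :: "int^'m^'m"
  assumes "\<And>i j. k dvd G $ i $ j"
  obtains H where "G = map_matrix ((*) k) H"
proof
  show "G = map_matrix ((*) k) (\<chi> i j. G $ i $ j div k)"
    using assms by (simp add: vec_eq_iff)
qed

text \<open>The squared index is exactly the factor by which scaling with \<open>k\<close>
  multiplies a determinant. So the form induced on the lattice, divided by \<open>k\<close>, keeps
  the determinant of \<open>F\<close>, as similarity demands.\<close>

lemma det_descent:
  fixes A F G :: "int^'m^'m"
  assumes "transpose A ** F ** A = map_matrix ((*) k) G" "(det A)\<^sup>2 = k ^ CARD('m)" "k \<noteq> 0"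
  shows "det G = det F"
proof -
  have "k ^ CARD('m) * det G = det (transpose A ** F ** A)" by (simp only: assms(1) det_scale)
  also have "\<dots> = (det A)\<^sup>2 * det F" by (simp add: det_mul power2_eq_square)
  finally show ?thesis using assms(2,3) by simp
qed

text \<open>Isotropy is built into \<open>sublattices\<close>. For the converse, if \<open>x\<close>
  is orthogonal to \<open>L\<close> modulo \<open>k\<close>, then both \<open>det F\<close> and
  \<open>det A\<close> times \<open>x\<close> lie in \<open>L\<close>. Since the square of
  \<open>det A\<close> is a power of \<open>k\<close>, these two multipliers are coprime, and
  \<open>x\<close> itself lies in \<open>L\<close>.\<close>

lemma sublattice_self_dual:
  fixes F :: "int^'m^'m"
  assumes L: "L \<in> sublattices k F" and F: "transpose F = F" "det F \<noteq> 0" "coprime k (det F)"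
    and k: "k \<noteq> 0"
  shows "self_dual k F L"
proof -
  obtain A where A: "L = range ((*v) A)" "(det A)\<^sup>2 = k ^ CARD('m)"
    "\<And>i j. k dvd (transpose A ** F ** A) $ i $ j"
    using L unfolding sublattices_def by blast
  obtain G where G: "transpose A ** F ** A = map_matrix ((*) k) G"
    using scaleE[OF A(3)] .
  have detG: "det G = det F" by (rule det_descent[OF G A(2) k])
  have detA: "det A \<noteq> 0"
  proof
    assume "det A = 0"
    then have "k ^ CARD('m) = 0" using A(2) by simp
    then show False using k by simp
  qed
  define C where "C = transpose A ** F"
  obtain H where H: "G ** H = mat (det F)" using ex_adjugate[of G] detG F(2) by metis
  have "det C \<noteq> 0" using detA F(2) by (simp add: C_def det_mul)
  \<comment> \<open>\<open>C ** A\<close> is \<open>k G\<close> and \<open>H\<close> inverts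
    \<open>G\<close> up to \<open>det F\<close>; cancelling the leftmost \<open>C\<close> then shows
    that \<open>A ** H\<close> inverts \<open>C\<close> up to \<open>k * det F\<close>.\<close>
  moreover have "C ** (A ** (H ** C)) = C ** mat (k * det F)"
  proof -
    have "C ** (A ** (H ** C)) = (map_matrix ((*) k) G ** H) ** C"
      by (simp only: C_def flip: G) (simp only: matrix_mul_assoc)
    also have "\<dots> = map_matrix ((*) k) (mat (det F)) ** C"
      by (simp only: map_matrix_mult_left H)
    also have "map_matrix ((*) k) (mat (det F)) = mat (k * det F)"
      by (simp add: vec_eq_iff mat_def)
    finally show ?thesis by (simp only: mat_mult_left mat_mult_right)
  qed
  ultimately have AHC: "A ** (H ** C) = mat (k * det F)" by (rule matrix_mult_left_cancel)
  obtain B where B: "A ** B = mat (det A)" using ex_adjugate[OF detA] by blast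
  have "coprime (k ^ CARD('m)) (det F)" using F(3) by simp
  then obtain u v where uv: "k ^ CARD('m) * u + det F * v = 1"
    by (metis bezout_int coprime_imp_gcd_eq_1 mult.commute)
  show ?thesis unfolding self_dual_def
  proof (intro equalityI subsetI CollectI ballI)
    fix x y assume "x \<in> L" "y \<in> L"
    then obtain x' y' where "x = A *v x'" "y = A *v y'" unfolding A(1) by auto
    then have "bilin F x y = bilin (transpose A ** F ** A) x' y'" by (simp only: bilin_mult_mult)
    then show "k dvd bilin F x y"
      by (simp add: bilin_def) (intro dvd_sum dvd_mult2 dvd_mult A(3))
  next
    fix x assume x: "x \<in> {x. \<forall>y\<in>L. k dvd bilin F x y}"
    have "k dvd (C *v x) $ i" for i
    proof -
      have "k dvd bilin F x (A *v axis i 1)" using x unfolding A(1) by blast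
      also have "bilin F x (A *v axis i 1) = bilin F (A *v axis i 1) x"
        by (rule bilin_commute[OF F(1)])
      also have "\<dots> = (C *v x) $ i"
        by (simp add: bilin_mult C_def axis_def if_distrib[of "\<lambda>x. x * _"]
            del: transpose_matrix_vector cong: if_cong)
      finally show ?thesis .
    qed
    then have "C *v x = k *s (\<chi> i. (C *v x) $ i div k)" by (simp add: vec_eq_iff)
    then obtain w where w: "C *v x = k *s w" by blast
    have "(k * det F) *s x = (A ** (H ** C)) *v x" by (simp only: AHC mat_mult_vec)
    also have "\<dots> = A *v (H *v (C *v x))" by (simp only: matrix_vector_mul_assoc matrix_mul_assoc)
    also have "\<dots> = k *s (A *v (H *v w))" by (simp only: w mult_vec_scale)
    finally have "(k * det F) *s x = k *s (A *v (H *v w))" .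
    then have 1: "det F *s x = A *v (H *v w)" using k by (simp add: vec_eq_iff mult.assoc)
    have 2: "det A *s x = A *v (B *v x)" by (simp add: matrix_vector_mul_assoc B mat_mult_vec)
    have "x = (k ^ CARD('m) * u + det F * v) *s x" by (simp add: uv)
    also have "\<dots> = (u * det A) *s (det A *s x) + v *s (det F *s x)"
      unfolding A(2)[symmetric] power2_eq_square by (simp add: vec_eq_iff algebra_simps)
    also have "\<dots> = A *v ((u * det A) *s (B *v x) + v *s (H *v w))"
      unfolding 1 2 by (simp add: matrix_vector_right_distrib mult_vec_scale)
    finally show "x \<in> L" unfolding A(1) by blast
  qed
qed

section \<open>Cosets of automorphs as lattices\<close>

text \<open>Off-diagonal terms occur in equal pairs by symmetry, and diagonal terms are
  even.\<close>

lemma even_bilin_integral_form: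
  assumes "integral_form F"
  shows "even (bilin F x x)"
proof -
  have "transpose F $ i $ j = F $ i $ j" for i j
    using assms by (simp add: integral_form_def)
  then have sym: "F $ i $ j = F $ j $ i" for i j by (simp add: transpose_def)
  have "even (\<Sum>i\<in>S. \<Sum>j\<in>S. x$i * F$i$j * x$j)" if "finite S" for S
    using that
  proof induction
    case (insert a S)
    have "(\<Sum>i\<in>insert a S. \<Sum>j\<in>insert a S. x$i * F$i$j * x$j)
        = x$a * F$a$a * x$a + (\<Sum>j\<in>S. x$a * F$a$j * x$j) + (\<Sum>i\<in>S. x$i * F$i$a * x$a)
          + (\<Sum>i\<in>S. \<Sum>j\<in>S. x$i * F$i$j * x$j)"
      using insert by (simp add: sum.distrib algebra_simps)
    also have "(\<Sum>i\<in>S. x$i * F$i$a * x$a) = (\<Sum>j\<in>S. x$a * F$a$j * x$j)"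
      by (rule sum.cong) (simp_all add: sym[of _ a] mult_ac)
    finally show ?case using insert assms by (simp add: integral_form_def)
  qed simp
  then show ?thesis by (simp add: bilin_def)
qed

lemma integral_form_congruent:
  assumes "integral_form F"
  shows "integral_form (transpose A ** F ** A)"
  unfolding integral_form_def
proof (intro conjI allI)
  have "transpose F = F" using assms by (simp add: integral_form_def)
  then show "transpose (transpose A ** F ** A) = transpose A ** F ** A"
    by (simp add: matrix_transpose_mul matrix_mul_assoc)
  show "even ((transpose A ** F ** A) $ i $ i)" for i
    using even_bilin_integral_form[OF assms, of "A *v axis i 1"]
    by (simp add: bilin_mult_mult bilin_axis)
qed

text \<open>The two maps have the same fibres on \<open>S\<close>, so sending \<open>f x\<close> to
  \<open>g x\<close> is well defined and bijective; \<open>s\<close> chooses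
  representatives.\<close>

lemma card_image_eqI:
  assumes "\<And>x y. x \<in> S \<Longrightarrow> y \<in> S \<Longrightarrow> f x = f y \<longleftrightarrow> g x = g y"
  shows "card (f ` S) = card (g ` S)"
proof (rule bij_betw_same_card)
  define s where "s = inv_into S f"
  have s: "s (f x) \<in> S \<and> f (s (f x)) = f x" if "x \<in> S" for x
    using that unfolding s_def by (simp add: f_inv_into_f inv_into_into)
  show "bij_betw (\<lambda>z. g (s z)) (f ` S) (g ` S)"
    unfolding bij_betw_def
  proof
    show "inj_on (\<lambda>z. g (s z)) (f ` S)"
    proof (rule inj_onI)
      fix a b assume "a \<in> f ` S" "b \<in> f ` S" and eq: "g (s a) = g (s b)"
      then have "s a \<in> S" "f (s a) = a" "s b \<in> S" "f (s b) = b" using s by auto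
      then show "a = b" using assms[of "s a" "s b"] eq by simp
    qed
    have "g (s (f x)) = g x" if "x \<in> S" for x
      using assms[of "s (f x)" x] s[OF that] that by simp
    then show "(\<lambda>z. g (s z)) ` f ` S = g ` S"
      unfolding image_image by (rule image_cong[OF refl])
  qed
qed

lemma int_equivalent_refl: "int_equivalent F F"
proof -
  have "invertible (mat 1 :: int^'m^'m)" unfolding invertible_def
    by (intro exI[of _ "mat 1"]) simp
  then show ?thesis unfolding int_equivalent_def by (intro exI[of _ "mat 1"]) simp
qed

lemma int_equivalent_trans:
  assumes "int_equivalent F G" "int_equivalent G H"
  shows "int_equivalent F H"
proof -
  obtain U where U: "invertible U" "G = transpose U ** F ** U"
    using assms(1) unfolding int_equivalent_def by (elim exE conjE)
  obtain V where V: "invertible V" "H = transpose V ** G ** V"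
    using assms(2) unfolding int_equivalent_def by (elim exE conjE)
  show ?thesis unfolding int_equivalent_def
    by (intro exI[of _ "U ** V"] conjI invertible_mult U V)
      (simp only: U V matrix_transpose_mul matrix_mul_assoc)
qed

lemma int_equivalent_det: "int_equivalent F G \<Longrightarrow> det G = det F"
proof -
  assume "int_equivalent F G"
  then obtain U where "invertible U" and G: "G = transpose U ** F ** U"
    unfolding int_equivalent_def by (elim exE conjE)
  have "det G = (det U)\<^sup>2 * det F" unfolding G by (simp add: det_mul power2_eq_square)
  then show ?thesis using det_square_invertible[OF \<open>invertible U\<close>] by simp
qed

lemma int_equivalent_integral_form: "int_equivalent F G \<Longrightarrow> integral_form F \<Longrightarrow> integral_form G"
  unfolding int_equivalent_def by (elim exE conjE) (simp add: integral_form_congruent)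

lemma scale_form_inject: "k \<noteq> 0 \<Longrightarrow> map_matrix ((*) k) F = map_matrix ((*) k) G \<longleftrightarrow> F = G"
  for F :: "int^'m^'n"
  by (simp add: vec_eq_iff)

lemma reps_scale_mult:
  assumes "A \<in> reps F (scale_form k G)"
  shows "transpose (A ** U) ** F ** (A ** U) = scale_form k (transpose U ** G ** U)"
proof -
  have "transpose (A ** U) ** F ** (A ** U) = transpose U ** (transpose A ** F ** A) ** U"
    by (simp only: matrix_transpose_mul matrix_mul_assoc)
  also have "\<dots> = scale_form k (transpose U ** G ** U)"
    using assms by (simp add: reps_def map_matrix_mult_left map_matrix_mult_right)
  finally show ?thesis .
qed

text \<open>Replacing the basis \<open>A\<close> of a lattice by \<open>A ** U\<close> transforms
  the represented form by \<open>U\<close>, and the factor \<open>k\<close> cancels. This is why the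
  lattice fixes the form up to equivalence.\<close>

lemma reps_scale_mult_iff:
  assumes "A \<in> reps F (scale_form k G)" "k \<noteq> 0"
  shows "A ** U \<in> reps F (scale_form k G') \<longleftrightarrow> G' = transpose U ** G ** U"
  unfolding reps_def mem_Collect_eq reps_scale_mult[OF assms(1)] scale_form_inject[OF assms(2)]
  by (rule eq_commute)

lemma coset_subset:
  assumes "A \<in> reps F (scale_form k G)" "A ** U \<in> reps F (scale_form k G)" "k \<noteq> 0" "invertible U"
  shows "(\<lambda>V. (A ** U) ** V) ` automorphs G \<subseteq> (\<lambda>V. A ** V) ` automorphs G"
proof (rule image_subsetI)
  fix V assume "V \<in> automorphs G"
  then have V: "transpose V ** G ** V = G" "invertible V"
    by (simp_all add: automorphs_def reps_def)
  have U: "transpose U ** G ** U = G" using reps_scale_mult_iff[OF assms(1,3)] assms(2) by simp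
  have "transpose (U ** V) ** G ** (U ** V) = transpose V ** (transpose U ** G ** U) ** V"
    by (simp only: matrix_transpose_mul matrix_mul_assoc)
  then have "U ** V \<in> automorphs G"
    using U V assms(4) by (simp add: automorphs_def reps_def invertible_mult)
  moreover have "A ** U ** V = A ** (U ** V)" by (simp only: matrix_mul_assoc)
  ultimately show "A ** U ** V \<in> (\<lambda>V. A ** V) ` automorphs G" by (rule rev_image_eqI)
qed

text \<open>Two matrices with the same column lattice differ by a unimodular \<open>U\<close>; as
  both represent the same multiple of \<open>G\<close>, this \<open>U\<close> preserves
  \<open>G\<close> and is an automorph.\<close>

lemma card_cosets:
  fixes F G :: "int^'m^'m"
  assumes "S \<subseteq> reps F (scale_form k G)" "k \<noteq> 0" "\<And>A. A \<in> S \<Longrightarrow> det A \<noteq> 0"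
  shows "card (cosets_mod_automorphs S G) = card ((\<lambda>A. range ((*v) A)) ` S)"
  unfolding cosets_mod_automorphs_def
proof (rule card_image_eqI)
  fix A B assume AB: "A \<in> S" "B \<in> S"
  have sub: "(\<lambda>V. B ** V) ` automorphs G \<subseteq> (\<lambda>V. A ** V) ` automorphs G"
    if "A \<in> S" "B \<in> S" and r: "range ((*v) B) = range ((*v) A)" for A B
  proof -
    obtain U where U: "invertible U" "B = A ** U"
      using r range_mult_eq_iff[of A B] assms(3)[OF \<open>A \<in> S\<close>] by auto
    show ?thesis unfolding U(2)
      by (rule coset_subset[OF _ _ assms(2) U(1)]) (use that assms(1) U(2) in auto)
  qed
  have "range ((*v) B) = range ((*v) A)"
    if eq: "(\<lambda>V. A ** V) ` automorphs G = (\<lambda>V. B ** V) ` automorphs G"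
  proof -
    have "invertible (mat 1 :: int^'m^'m)" unfolding invertible_def
      by (intro exI[of _ "mat 1"]) simp
    then have "mat 1 \<in> automorphs G" by (simp add: automorphs_def reps_def)
    then have "B ** mat 1 \<in> (\<lambda>V. A ** V) ` automorphs G" unfolding eq by (rule imageI)
    then obtain V where "B = A ** V" "V \<in> automorphs G" by (auto simp only: matrix_mul_rid)
    then show ?thesis by (simp add: automorphs_def range_mult_invertible)
  qed
  then show "(\<lambda>V. A ** V) ` automorphs G = (\<lambda>V. B ** V) ` automorphs G
      \<longleftrightarrow> range ((*v) A) = range ((*v) B)"
    using sub[OF AB] sub[OF AB(2,1)] by (metis subset_antisym)
qed

text \<open>Every lattice in \<open>\<M>\<close> carries a form of the similarity class, so it
  arises from some \<open>r i\<close>; it arises from only one, because a common lattice would make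
  two representatives equivalent. \<open>T\<close> is a restriction invariant under change of basis:
  primitivity for the ternary sum, \<open>UNIV\<close> for the quaternary one.\<close>

lemma sum_card_cosets:
  fixes F :: "int^'m^'m"
  assumes cs: "complete_system (similarity_class F) h r"
    and F: "integral_form F" "det F \<noteq> 0" "coprime k (det F)" and k: "odd k"
    and T: "\<And>A U. A \<in> T \<Longrightarrow> invertible U \<Longrightarrow> A ** U \<in> T"
    and M_def: "\<M> = {range ((*v) A) |A. A \<in> T \<and> (det A)\<^sup>2 = k ^ CARD('m)
        \<and> (\<forall>i j. k dvd (transpose A ** F ** A) $ i $ j)}"
    and fin: "finite \<M>"
  shows "(\<Sum>i=1..h. card (cosets_mod_automorphs (reps F (scale_form k (r i)) \<inter> T) (r i)))
    = card \<M>"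
proof -
  have k0: "k \<noteq> 0" using k by auto
  define S where "S i = reps F (scale_form k (r i)) \<inter> T" for i
  define \<L> where "\<L> i = (\<lambda>A. range ((*v) A)) ` S i" for i
  have r: "integral_form (r i)" "det (r i) = det F" if "i \<in> {1..h}" for i
    using cs that unfolding complete_system_def similarity_class_def by blast+
  have detA: "(det A)\<^sup>2 = k ^ CARD('m)" if "i \<in> {1..h}" "A \<in> S i" for i A
  proof -
    have "transpose A ** F ** A = scale_form k (r i)" using that by (simp add: S_def reps_def)
    then have "det (transpose A ** F ** A) = k ^ CARD('m) * det F"
      using r[OF that(1)] by (simp only: det_scale)
    then show ?thesis using F(2) by (simp add: det_mul power2_eq_square)
  qed
  have card: "card (cosets_mod_automorphs (S i) (r i)) = card (\<L> i)" if "i \<in> {1..h}" for i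
    unfolding \<L>_def
  proof (rule card_cosets[OF _ k0])
    show "S i \<subseteq> reps F (scale_form k (r i))" by (simp add: S_def)
    show "det A \<noteq> 0" if "A \<in> S i" for A
      using detA[OF \<open>i \<in> {1..h}\<close> that] k0 by (intro notI) simp
  qed
  have L: "\<M> = (\<Union>i\<in>{1..h}. \<L> i)"
  proof (intro equalityI subsetI)
    fix L assume "L \<in> \<M>"
    then obtain A where A: "L = range ((*v) A)" "A \<in> T" "(det A)\<^sup>2 = k ^ CARD('m)"
      "\<And>i j. k dvd (transpose A ** F ** A) $ i $ j" unfolding M_def by blast
    obtain G where G: "transpose A ** F ** A = scale_form k G" using scaleE[OF A(4)] .
    then have AG: "A \<in> reps F (scale_form k G)" by (simp add: reps_def)
    have "integral_form (scale_form k G)" using integral_form_congruent[OF F(1), of A] G by simp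
    \<comment> \<open>Oddness of \<open>k\<close> lets evenness of the diagonal descend from
      \<open>k G\<close> to \<open>G\<close>.\<close>
    then have "integral_form G"
      using k k0 by (simp add: integral_form_def vec_eq_iff transpose_def)
    moreover have "det G = det F" by (rule det_descent[OF G A(3) k0])
    \<comment> \<open>The multiplier \<open>a\<close> in the definition of similarity is
      \<open>k\<close> itself.\<close>
    ultimately have "G \<in> similarity_class F"
      using AG k0 F(3) unfolding similarity_class_def by blast
    then obtain i where i: "i \<in> {1..h}" "int_equivalent (r i) G"
      using cs unfolding complete_system_def by blast
    then obtain U where U: "invertible U" "G = transpose U ** r i ** U"
      unfolding int_equivalent_def by (elim bexE exE conjE)
    obtain V where V: "U ** V = mat 1" "V ** U = mat 1"
      using U(1) unfolding invertible_def by (elim exE conjE)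
    \<comment> \<open>Passing to the basis \<open>A ** V\<close> of the same lattice turns the
      induced form into the chosen representative exactly.\<close>
    have "transpose V ** G ** V = transpose (U ** V) ** r i ** (U ** V)"
      unfolding U(2) by (simp only: matrix_transpose_mul matrix_mul_assoc)
    then have "r i = transpose V ** G ** V" by (simp add: V)
    then have "A ** V \<in> reps F (scale_form k (r i))"
      using reps_scale_mult_iff[OF AG k0] by simp
    moreover have inv: "invertible V" unfolding invertible_def
      by (intro exI[of _ U] conjI V)
    ultimately have "A ** V \<in> S i" using T A(2) by (simp add: S_def)
    moreover have "L = range ((*v) (A ** V))" unfolding A(1) by (simp only: range_mult_invertible[OF inv])
    ultimately have "L \<in> \<L> i" unfolding \<L>_def by (rule rev_image_eqI)
    then show "L \<in> (\<Union>i\<in>{1..h}. \<L> i)" using i(1) by (rule UN_I[rotated])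
  next
    fix L assume "L \<in> (\<Union>i\<in>{1..h}. \<L> i)"
    then obtain i A where A: "i \<in> {1..h}" "A \<in> S i" "L = range ((*v) A)"
      unfolding \<L>_def by (elim UN_E imageE)
    have "transpose A ** F ** A = scale_form k (r i)" using A(2) by (simp add: S_def reps_def)
    then have "\<forall>i j. k dvd (transpose A ** F ** A) $ i $ j" by simp
    moreover have "A \<in> T" using A(2) by (simp add: S_def)
    ultimately show "L \<in> \<M>"
      unfolding M_def using detA[OF A(1,2)] A(3) by (intro CollectI exI[of _ A] conjI)
  qed
  have disj: "\<L> i \<inter> \<L> j = {}" if ij: "i \<in> {1..h}" "j \<in> {1..h}" "i \<noteq> j" for i j
  proof (rule ccontr)
    assume "\<L> i \<inter> \<L> j \<noteq> {}"
    then obtain A B where AB: "A \<in> S i" "B \<in> S j" "range ((*v) B) = range ((*v) A)"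
      unfolding \<L>_def by blast
    have "det A \<noteq> 0" using detA[OF ij(1) AB(1)] k0 by (intro notI) simp
    then obtain U where U: "invertible U" "B = A ** U" using AB(3) range_mult_eq_iff[of A B] by auto
    have "r j = transpose U ** r i ** U"
      using AB reps_scale_mult_iff[OF _ k0, of A F "r i" U "r j"] by (simp add: S_def U(2))
    then have "int_equivalent (r i) (r j)" unfolding int_equivalent_def
      by (intro exI[of _ U] conjI U)
    \<comment> \<open>Both \<open>i\<close> and \<open>j\<close> would then index the class of
      \<open>r j\<close>, against uniqueness in the complete system.\<close>
    moreover have "int_equivalent (r j) (r j)" by (rule int_equivalent_refl)
    moreover have "r j \<in> similarity_class F" using cs ij unfolding complete_system_def by blast
    ultimately show False using cs ij unfolding complete_system_def by blast
  qed
  have finL: "finite (\<L> i)" if "i \<in> {1..h}" for i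
  proof (rule finite_subset[OF _ fin])
    show "\<L> i \<subseteq> \<M>" unfolding L using that by (rule UN_upper)
  qed
  have "(\<Sum>i=1..h. card (cosets_mod_automorphs (S i) (r i))) = (\<Sum>i=1..h. card (\<L> i))"
    by (rule sum.cong) (simp_all add: card)
  also have "\<dots> = card \<M>" unfolding L
    by (rule card_UN_disjoint[symmetric]) (use finL disj in auto)
  finally show ?thesis unfolding S_def .
qed

text \<open>A property of the lattice rather than of a basis matrix. For index a power of
  \<open>p\<close> it amounts to the matrix entries having gcd \<open>1\<close>.\<close>

definition primitive_at :: "int \<Rightarrow> (int^'m) set \<Rightarrow> bool"
  where "primitive_at p L \<longleftrightarrow> (\<exists>x\<in>L. \<exists>i. \<not> p dvd x $ i)"

lemma dvd_mult_vec: "(\<And>i. p dvd x $ i) \<Longrightarrow> p dvd (A *v x) $ j"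
  for A :: "int^'n^'m"
  unfolding matrix_vector_mult_def by (auto intro!: dvd_sum)

lemma image_mult_range: "(*v) U ` range ((*v) A) = range ((*v) (U ** A))"
  for U :: "'a::comm_ring_1^'n^'m"
  unfolding image_image by (simp only: matrix_vector_mul_assoc)

text \<open>The base change \<open>U\<close> is an isometry from \<open>G\<close> to
  \<open>F\<close>, and being unimodular it respects indices and divisibility of vectors.\<close>

lemma sublattices_equivalent:
  fixes F G :: "int^'m^'m"
  assumes "int_equivalent F G"
  obtains f where "bij_betw f (sublattices k G) (sublattices k F)"
    "\<forall>p L. primitive_at p (f L) \<longleftrightarrow> primitive_at p L"
proof -
  obtain U where U: "invertible U" "G = transpose U ** F ** U"
    using assms unfolding int_equivalent_def by (elim exE conjE)
  obtain V where V: "U ** V = mat 1" "V ** U = mat 1"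
    using U(1) unfolding invertible_def by (elim exE conjE)
  have VU: "V *v (U *v x) = x" for x by (simp add: matrix_vector_mul_assoc V)
  have detU: "(det U)\<^sup>2 = 1" "(det V)\<^sup>2 = 1"
    using V U(1) by (auto intro!: det_square_invertible simp: invertible_def)
  define f where "f = (\<lambda>L. (*v) U ` L)"
  have "inj ((*v) U)" by (rule inj_on_inverseI) (rule VU)
  then have "inj_on f (sublattices k G)" unfolding f_def
    by (metis inj_on_image inj_on_subset subset_UNIV inj_image_eq_iff inj_onI)
  moreover have "f ` sublattices k G = sublattices k F"
  proof (intro equalityI subsetI)
    fix L assume "L \<in> f ` sublattices k G"
    then obtain A where A: "L = f (range ((*v) A))" "(det A)\<^sup>2 = k ^ CARD('m)"
      "\<forall>i j. k dvd (transpose A ** G ** A) $ i $ j"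
      unfolding sublattices_def by blast
    have "transpose (U ** A) ** F ** (U ** A) = transpose A ** G ** A"
      by (simp only: U(2) matrix_transpose_mul matrix_mul_assoc)
    moreover have "(det (U ** A))\<^sup>2 = k ^ CARD('m)" by (simp add: det_mul power_mult_distrib detU A)
    moreover have "L = range ((*v) (U ** A))" by (simp only: A(1) f_def image_mult_range)
    ultimately show "L \<in> sublattices k F" unfolding sublattices_def using A(3)
      by (intro CollectI exI[of _ "U ** A"] conjI) simp_all
  next
    fix L assume "L \<in> sublattices k F"
    then obtain A where A: "L = range ((*v) A)" "(det A)\<^sup>2 = k ^ CARD('m)"
      "\<forall>i j. k dvd (transpose A ** F ** A) $ i $ j"
      unfolding sublattices_def by blast
    have UVA: "U ** (V ** A) = A" by (simp add: matrix_mul_assoc V)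
    have "transpose (V ** A) ** G ** (V ** A) = transpose (U ** (V ** A)) ** F ** (U ** (V ** A))"
      unfolding U(2) by (simp only: matrix_transpose_mul matrix_mul_assoc)
    then have "transpose (V ** A) ** G ** (V ** A) = transpose A ** F ** A" by (simp only: UVA)
    moreover have "(det (V ** A))\<^sup>2 = k ^ CARD('m)" by (simp add: det_mul power_mult_distrib detU A)
    ultimately have "range ((*v) (V ** A)) \<in> sublattices k G" unfolding sublattices_def using A(3)
      by (intro CollectI exI[of _ "V ** A"] conjI) simp_all
    moreover have "L = f (range ((*v) (V ** A)))" by (simp only: A(1) f_def image_mult_range UVA)
    ultimately show "L \<in> f ` sublattices k G" by (rule rev_image_eqI)
  qed
  ultimately have "bij_betw f (sublattices k G) (sublattices k F)" unfolding bij_betw_def ..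
  moreover have "\<forall>p L. primitive_at p (f L) \<longleftrightarrow> primitive_at p L"
  proof (intro allI)
    fix p :: int and L :: "(int^'m) set"
    have "(\<exists>i. \<not> p dvd (U *v x) $ i) \<longleftrightarrow> (\<exists>i. \<not> p dvd x $ i)" for x
      using dvd_mult_vec[of p "U *v x" V] dvd_mult_vec[of p x U] unfolding VU by blast
    then show "primitive_at p (f L) \<longleftrightarrow> primitive_at p L"
      unfolding primitive_at_def f_def by simp
  qed
  ultimately show thesis by (rule that)
qed

section \<open>Normal forms modulo an odd prime\<close>

lemma linear_congruence:
  fixes a b k :: int
  assumes "coprime a k"
  obtains x where "k dvd b + a * x"
proof -
  obtain y where "[a * y = 1] (mod k)" using assms cong_solve_coprime_int by blast
  then have "[b + a * (- b * y) = 0] (mod k)"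
    using cong_scalar_left[of "a * y" 1 k "- b"] by (simp add: cong_iff_dvd_diff algebra_simps)
  then show thesis using that[of "- b * y"] by (simp add: cong_0_iff)
qed

text \<open>\<open>p\<close> divides \<open>x - y\<close> or \<open>x + y\<close>, both smaller than
  \<open>p\<close> in absolute value.\<close>

lemma prime_dvd_square_diffD:
  fixes p x y :: int
  assumes p: "prime p" and "p dvd x\<^sup>2 - y\<^sup>2" and "0 \<le> x" "0 \<le> y" "2 * x < p" "2 * y < p"
  shows "x = y"
proof -
  have "p dvd (x - y) * (x + y)" using assms(2) by (simp add: power2_eq_square algebra_simps)
  then have "p dvd x - y \<or> p dvd x + y" using p prime_dvd_multD by blast
  then show ?thesis
  proof
    assume "p dvd x - y"
    then show ?thesis using assms zdvd_imp_le[of p "x - y"] zdvd_imp_le[of p "y - x"]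
      by (cases x y rule: linorder_cases) (auto simp: dvd_diff_commute)
  next
    assume "p dvd x + y"
    then show ?thesis using assms zdvd_imp_le[of p "x + y"] by (cases "x + y = 0") auto
  qed
qed

text \<open>Pigeonhole: \<open>b x^2\<close> and \<open>- D - y^2\<close> each take
  \<open>(p + 1) / 2\<close> distinct values modulo \<open>p\<close>, too many to be
  disjoint.\<close>

lemma binary_square_form_represents:
  fixes p b D :: int
  assumes p: "prime p" "odd p" and b: "\<not> p dvd b"
  obtains x y where "p dvd b * x\<^sup>2 + y\<^sup>2 + D"
proof -
  define S where "S = {0..(p - 1) div 2}"
  have p0: "p > 0" using p(1) prime_gt_0_int by blast
  have S: "0 \<le> x \<and> 2 * x < p" if "x \<in> S" for x using that p(2) by (auto simp: S_def)
  have cardS: "int (card S) = (p + 1) div 2" using p0 p(2) by (auto simp: S_def elim!: oddE)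
  have inj1: "inj_on (\<lambda>x. (b * x\<^sup>2) mod p) S"
  proof (rule inj_onI)
    fix x y assume xy: "x \<in> S" "y \<in> S" and "(b * x\<^sup>2) mod p = (b * y\<^sup>2) mod p"
    then have "p dvd b * (x\<^sup>2 - y\<^sup>2)" by (simp add: mod_eq_dvd_iff algebra_simps)
    then have "p dvd x\<^sup>2 - y\<^sup>2" using p(1) b prime_dvd_multD by blast
    then show "x = y" using prime_dvd_square_diffD[OF p(1)] S xy by blast
  qed
  have inj2: "inj_on (\<lambda>y. (- D - y\<^sup>2) mod p) S"
  proof (rule inj_onI)
    fix x y assume xy: "x \<in> S" "y \<in> S" and "(- D - x\<^sup>2) mod p = (- D - y\<^sup>2) mod p"
    then have "p dvd y\<^sup>2 - x\<^sup>2" by (simp add: mod_eq_dvd_iff)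
    then have "y = x" using prime_dvd_square_diffD[OF p(1)] S xy by blast
    then show "x = y" ..
  qed
  have "(\<lambda>x. (b * x\<^sup>2) mod p) ` S \<inter> (\<lambda>y. (- D - y\<^sup>2) mod p) ` S \<noteq> {}" (is "?A \<inter> ?B \<noteq> {}")
  proof
    assume "?A \<inter> ?B = {}"
    then have "card (?A \<union> ?B) = card S + card S"
      using inj1 inj2 by (simp add: card_Un_disjoint card_image S_def)
    moreover have "card (?A \<union> ?B) \<le> card {0..<p}"
      using p0 by (intro card_mono) auto
    ultimately have "2 * int (card S) \<le> p" using p0 by simp
    then show False using cardS p(2) by (auto elim!: oddE)
  qed
  then obtain x y where "(b * x\<^sup>2) mod p = (- D - y\<^sup>2) mod p" by auto
  then have "p dvd b * x\<^sup>2 + y\<^sup>2 + D" by (simp add: mod_eq_dvd_iff algebra_simps)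
  then show thesis by (rule that)
qed

text \<open>Proved by completing squares. The coordinate equal to \<open>1\<close> makes the
  isotropic vector extendable to a basis of the integral lattice.\<close>

lemma ternary_isotropic_mod_prime:
  fixes p a b c d e f :: int
  assumes p: "prime p" "odd p"
  obtains x y z where "p dvd a * x\<^sup>2 + b * y\<^sup>2 + c * z\<^sup>2 + 2 * d * x * y + 2 * e * x * z + 2 * f * y * z"
    "x = 1 \<or> y = 1 \<or> z = 1"
proof (cases "p dvd a")
  case True
  then show thesis using that[of 1 0 0] by simp
next
  case a: False
  have cop: "coprime u p" if "\<not> p dvd u" for u
    using that p(1) by (simp add: prime_imp_coprime coprime_commute)
  define \<beta> where "\<beta> = a * b - d\<^sup>2"
  show thesis
  proof (cases "p dvd \<beta>")
    case True
    \<comment> \<open>The degenerate binary part in the first two variables is a square up to a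
      unit; its root gives the vector \<open>(x, 1, 0)\<close>.\<close>
    obtain x where x: "p dvd d + a * x" using linear_congruence[OF cop[OF a]] .
    have "a * (a * x\<^sup>2 + b + 2 * d * x) = (d + a * x) * (d + a * x) + \<beta>"
      by (simp add: \<beta>_def power2_eq_square algebra_simps)
    then have "p dvd a * (a * x\<^sup>2 + b + 2 * d * x)" using x True by simp
    then have "p dvd a * x\<^sup>2 + b + 2 * d * x" using a p(1) prime_dvd_multD by blast
    then show thesis using that[of x 1 0] by simp
  next
    case b: False
    define \<gamma> where "\<gamma> = a * f - d * e"
    define \<delta> where "\<delta> = a * c - e\<^sup>2"
    \<comment> \<open>With third coordinate \<open>1\<close>, completing the square twice leads to
      the variables \<open>X = a x + d y + e\<close> and \<open>Y = \<beta> y + \<gamma>\<close>.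
      The system is triangular with unit coefficients, so \<open>y\<close> and then \<open>x\<close>
      can be recovered.\<close>
    obtain X Y where XY: "p dvd \<beta> * X\<^sup>2 + Y\<^sup>2 + (\<beta> * \<delta> - \<gamma>\<^sup>2)"
      using binary_square_form_represents[OF p b] .
    obtain y where y: "p dvd (\<gamma> - Y) + \<beta> * y" using linear_congruence[OF cop[OF b]] .
    obtain x where x: "p dvd (d * y + e - X) + a * x" using linear_congruence[OF cop[OF a]] .
    let ?q = "a * x\<^sup>2 + b * y\<^sup>2 + c + 2 * d * x * y + 2 * e * x + 2 * f * y"
    have q: "\<beta> * a * ?q = \<beta> * (a * x + d * y + e)\<^sup>2 + (\<beta> * y + \<gamma>)\<^sup>2 + (\<beta> * \<delta> - \<gamma>\<^sup>2)"
      unfolding \<beta>_def \<gamma>_def \<delta>_def by (simp add: power2_eq_square algebra_simps)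
    have "[\<beta> * (a * x + d * y + e)\<^sup>2 + (\<beta> * y + \<gamma>)\<^sup>2 + (\<beta> * \<delta> - \<gamma>\<^sup>2)
        = \<beta> * X\<^sup>2 + Y\<^sup>2 + (\<beta> * \<delta> - \<gamma>\<^sup>2)] (mod p)"
      using x y by (intro cong_add cong_mult cong_pow cong_refl) (simp_all add: cong_iff_dvd_diff algebra_simps)
    then have "p dvd (\<beta> * a) * ?q" unfolding q using XY by (simp only: cong_dvd_iff)
    then have "p dvd ?q" using a b p(1) by (metis prime_dvd_mult_iff)
    then show thesis using that[of x y 1] by simp
  qed
qed

text \<open>The rows of \<open>W\<close> are the new basis vectors, so a base change can be written
  as a list of vectors.\<close>

lemma int_equivalent_gram:
  fixes F W :: "int^'m^'m"
  assumes "(det W)\<^sup>2 = 1"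
  obtains G where "int_equivalent F G" "\<forall>i j. G $ i $ j = bilin F (W $ i) (W $ j)"
proof
  have "invertible (transpose W)" using assms by (intro invertible_if_det_square) simp
  then show "int_equivalent F (transpose (transpose W) ** F ** transpose W)"
    unfolding int_equivalent_def by (intro exI[of _ "transpose W"] conjI refl)
  have W: "transpose W *v axis i 1 = W $ i" for i
    unfolding mult_axis by (simp add: row_def vec_eq_iff)
  show "\<forall>i j. (transpose (transpose W) ** F ** transpose W) $ i $ j = bilin F (W $ i) (W $ j)"
    unfolding bilin_axis[symmetric] bilin_mult_mult[symmetric] W by (intro allI refl)
qed

lemma integral_form_sym: "integral_form F \<Longrightarrow> F $ i $ j = F $ j $ i"
proof -
  assume "integral_form F"
  then have "transpose F $ i $ j = F $ i $ j" by (simp add: integral_form_def)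
  then show ?thesis by (simp add: transpose_def)
qed

lemma bilin_3: "bilin F x y = x$1 * (F$1$1 * y$1 + F$1$2 * y$2 + F$1$3 * y$3)
    + x$2 * (F$2$1 * y$1 + F$2$2 * y$2 + F$2$3 * y$3)
    + x$3 * (F$3$1 * y$1 + F$3$2 * y$2 + F$3$3 * y$3)" for F :: "'a::comm_ring_1^3^3"
  by (simp add: bilin_conv_sum sum_3 matrix_vector_mult_def)

lemma bilin_4: "bilin F x y = x$1 * (F$1$1 * y$1 + F$1$2 * y$2 + F$1$3 * y$3 + F$1$4 * y$4)
    + x$2 * (F$2$1 * y$1 + F$2$2 * y$2 + F$2$3 * y$3 + F$2$4 * y$4)
    + x$3 * (F$3$1 * y$1 + F$3$2 * y$2 + F$3$3 * y$3 + F$3$4 * y$4)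
    + x$4 * (F$4$1 * y$1 + F$4$2 * y$2 + F$4$3 * y$3 + F$4$4 * y$4)" for F :: "'a::comm_ring_1^4^4"
  by (simp add: bilin_conv_sum sum_4 matrix_vector_mult_def)

lemma ternary_isotropic_basis:
  fixes Q :: "int^3^3"
  assumes p: "prime p" "odd p" and Q: "integral_form Q"
  obtains G where "int_equivalent Q G" "p dvd G $ 1 $ 1"
proof -
  note sym = integral_form_sym[OF Q]
  obtain x y z where "p dvd Q$1$1 * x\<^sup>2 + Q$2$2 * y\<^sup>2 + Q$3$3 * z\<^sup>2
      + 2 * Q$1$2 * x * y + 2 * Q$1$3 * x * z + 2 * Q$2$3 * y * z" and 1: "x = 1 \<or> y = 1 \<or> z = 1"
    using ternary_isotropic_mod_prime[OF p] .
  then have iso: "p dvd bilin Q (vector [x, y, z]) (vector [x, y, z])"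
    by (simp add: bilin_3 sym[of 2 1] sym[of 3 1] sym[of 3 2] power2_eq_square algebra_simps)
  \<comment> \<open>The unit vectors away from a coordinate equal to \<open>1\<close> complete the
    isotropic vector to a basis.\<close>
  define W :: "int^3^3" where "W = vector [vector [x, y, z],
    if x = 1 then vector [0, 1, 0] else vector [1, 0, 0],
    if x = 1 \<or> y = 1 then vector [0, 0, 1] else vector [0, 1, 0]]"
  have W: "(det W)\<^sup>2 = 1" using 1 by (auto simp: W_def det_3)
  obtain G where G: "int_equivalent Q G" "\<forall>i j. G $ i $ j = bilin Q (W $ i) (W $ j)"
    using int_equivalent_gram[OF W, of Q] .
  have "p dvd G $ 1 $ 1" using iso by (simp add: G(2) W_def)
  with G(1) show thesis by (rule that)
qed

text \<open>Nonsingularity modulo \<open>p\<close> gives the isotropic vector a partner with unit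
  pairing; it is moved to position \<open>3\<close>.\<close>

lemma ternary_hyperbolic_basis:
  fixes Q :: "int^3^3"
  assumes p: "prime p" "odd p" and Q: "integral_form Q" "\<not> p dvd det Q"
  obtains G where "int_equivalent Q G" "p dvd G $ 1 $ 1" "\<not> p dvd G $ 1 $ 3"
proof -
  obtain G where G: "int_equivalent Q G" "p dvd G $ 1 $ 1"
    using ternary_isotropic_basis[OF p Q(1)] .
  show thesis
  proof (cases "p dvd G $ 1 $ 3")
    case False
    then show thesis using that G by blast
  next
    case True
    have "\<not> p dvd det G" using Q(2) int_equivalent_det[OF G(1)] by simp
    have 2: "\<not> p dvd G $ 1 $ 2"
    proof
      assume "p dvd G $ 1 $ 2"
      then have "\<forall>j. p dvd G $ 1 $ j" using True G(2) by (simp add: forall_3)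
      then show False using dvd_det_row[of p G 1] \<open>\<not> p dvd det G\<close> by blast
    qed
    define W :: "int^3^3" where "W = vector [vector [1, 0, 0], vector [0, 0, 1], vector [0, 1, 0]]"
    have W: "(det W)\<^sup>2 = 1" by (simp add: W_def det_3)
    obtain H where H: "int_equivalent G H" "\<forall>i j. H $ i $ j = bilin G (W $ i) (W $ j)"
    using int_equivalent_gram[OF W, of G] .
    have "p dvd H $ 1 $ 1" "\<not> p dvd H $ 1 $ 3"
      using 2 G(2) by (simp_all add: H(2) W_def bilin_3)
    then show thesis using that int_equivalent_trans[OF G(1) H(1)] by blast
  qed
qed

text \<open>Hensel step: adding \<open>p s\<close> times the third basis vector to the first changes
  its norm by \<open>2 p s\<close> times a unit, modulo \<open>p^2\<close>.\<close>

lemma ternary_hyperbolic_basis_square: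
  fixes Q :: "int^3^3"
  assumes p: "prime p" "odd p" and Q: "integral_form Q" "\<not> p dvd det Q"
  obtains G where "int_equivalent Q G" "p\<^sup>2 dvd G $ 1 $ 1" "\<not> p dvd G $ 1 $ 3"
proof -
  obtain G where G: "int_equivalent Q G" "p dvd G $ 1 $ 1" "\<not> p dvd G $ 1 $ 3"
    using ternary_hyperbolic_basis[OF p Q] .
  note sym = integral_form_sym[OF int_equivalent_integral_form[OF G(1) Q(1)]]
  obtain c where c: "G $ 1 $ 1 = p * c" using G(2) by (elim dvdE)
  have "coprime 2 p" using p(2) by simp
  moreover have "coprime (G $ 1 $ 3) p"
    using p(1) G(3) by (simp add: prime_imp_coprime coprime_commute[of _ p])
  ultimately have "coprime (2 * G $ 1 $ 3) p" by simp
  then obtain s where "p dvd c + 2 * G $ 1 $ 3 * s" by (rule linear_congruence)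
  then obtain t where t: "c + 2 * G $ 1 $ 3 * s = p * t" by (elim dvdE)
  define W :: "int^3^3"
    where "W = vector [vector [1, 0, p * s], vector [0, 1, 0], vector [0, 0, 1]]"
  have W: "(det W)\<^sup>2 = 1" by (simp add: W_def det_3)
  obtain H where H: "int_equivalent G H" "\<forall>i j. H $ i $ j = bilin G (W $ i) (W $ j)"
    using int_equivalent_gram[OF W, of G] .
  have "H $ 1 $ 1 = p * (c + 2 * G $ 1 $ 3 * s) + p\<^sup>2 * (s\<^sup>2 * G $ 3 $ 3)"
    by (simp add: H(2) W_def bilin_3 c sym[of 3 1] power2_eq_square algebra_simps)
  also have "\<dots> = p\<^sup>2 * (t + s\<^sup>2 * G $ 3 $ 3)"
    by (simp only: t) (simp add: power2_eq_square algebra_simps)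
  finally have "p\<^sup>2 dvd H $ 1 $ 1" by simp
  moreover have "\<not> p dvd H $ 1 $ 3"
    using G(3) by (simp add: H(2) W_def bilin_3 dvd_add_left_iff mult.assoc)
  ultimately show thesis using that int_equivalent_trans[OF G(1) H(1)] by blast
qed

definition hyp3 :: "int \<Rightarrow> int \<Rightarrow> int^3^3"
  where "hyp3 a b = vector [vector [0, 0, a], vector [0, b, 0], vector [a, 0, 0]]"

text \<open>The first and third vectors span a hyperbolic plane that splits off modulo
  \<open>p^2\<close>. The determinant of \<open>hyp3 a b\<close> is \<open>- a^2 b\<close>, so
  nonsingularity makes both parameters units.\<close>

lemma ternary_normal_form:
  fixes Q :: "int^3^3"
  assumes p: "prime p" "odd p" and Q: "integral_form Q" "\<not> p dvd det Q"
  obtains G a b where "int_equivalent Q G" "\<not> p dvd a" "\<not> p dvd b"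
    "\<And>i j. [G $ i $ j = hyp3 a b $ i $ j] (mod p\<^sup>2)"
proof -
  obtain G where G: "int_equivalent Q G" "p\<^sup>2 dvd G $ 1 $ 1" "\<not> p dvd G $ 1 $ 3"
    using ternary_hyperbolic_basis_square[OF p Q] .
  note sym = integral_form_sym[OF int_equivalent_integral_form[OF G(1) Q(1)]]
  have cop: "coprime (G $ 1 $ 3) (p\<^sup>2)"
    using p(1) G(3) by (simp add: prime_imp_coprime coprime_commute[of _ p])
  have "coprime 2 (p\<^sup>2)" using p(2) by simp
  with cop have cop2: "coprime (2 * G $ 1 $ 3) (p\<^sup>2)" by simp
  \<comment> \<open>\<open>t\<close> makes the third vector isotropic, \<open>r\<close> makes the
    second orthogonal to the first, and \<open>s\<close> makes it orthogonal to the corrected third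
    vector.\<close>
  obtain t where t: "p\<^sup>2 dvd G $ 3 $ 3 + 2 * G $ 1 $ 3 * t" using linear_congruence[OF cop2] .
  obtain r where r: "p\<^sup>2 dvd G $ 1 $ 2 + G $ 1 $ 3 * r" using linear_congruence[OF cop] .
  obtain s where s: "p\<^sup>2 dvd G $ 2 $ 3 + t * G $ 1 $ 2 + r * G $ 3 $ 3 + r * t * G $ 1 $ 3 + G $ 1 $ 3 * s"
    using linear_congruence[OF cop] .
  define W :: "int^3^3"
    where "W = vector [vector [1, 0, 0], vector [s, 1, r], vector [t, 0, 1]]"
  have W: "(det W)\<^sup>2 = 1" by (simp add: W_def det_3)
  obtain H where H: "int_equivalent G H" "\<forall>i j. H $ i $ j = bilin G (W $ i) (W $ j)"
    using int_equivalent_gram[OF W, of G] .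
  have QH: "int_equivalent Q H" by (rule int_equivalent_trans[OF G(1) H(1)])
  note symH = integral_form_sym[OF int_equivalent_integral_form[OF QH Q(1)]]
  have h11: "H $ 1 $ 1 = G $ 1 $ 1"
    and h12: "H $ 1 $ 2 = (G $ 1 $ 2 + G $ 1 $ 3 * r) + s * G $ 1 $ 1"
    and h13: "H $ 1 $ 3 = G $ 1 $ 3 + t * G $ 1 $ 1"
    and h23: "H $ 2 $ 3 = (G $ 2 $ 3 + t * G $ 1 $ 2 + r * G $ 3 $ 3 + r * t * G $ 1 $ 3 + G $ 1 $ 3 * s)
        + s * t * G $ 1 $ 1"
    and h33: "H $ 3 $ 3 = (G $ 3 $ 3 + 2 * G $ 1 $ 3 * t) + t\<^sup>2 * G $ 1 $ 1"
    by (simp_all add: H(2) W_def bilin_3 sym[of 2 1] sym[of 3 1] sym[of 3 2] power2_eq_square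
        algebra_simps)
  have d: "p\<^sup>2 dvd H $ 1 $ 1" "p\<^sup>2 dvd H $ 1 $ 2" "p\<^sup>2 dvd H $ 2 $ 3" "p\<^sup>2 dvd H $ 3 $ 3"
    unfolding h11 h12 h23 h33 using G(2) r s t by (auto intro!: dvd_add)
  have "H $ i $ j = H $ j $ i" for i j by (rule symH)
  then have cong: "[H $ i $ j = hyp3 (H $ 1 $ 3) (H $ 2 $ 2) $ i $ j] (mod p\<^sup>2)" for i j
    using exhaust_3[of i] exhaust_3[of j] d symH[of 2 1] symH[of 3 1] symH[of 3 2]
    by (auto simp: hyp3_def cong_0_iff)
  have "\<not> p dvd det H" using Q(2) int_equivalent_det[OF QH] by simp
  moreover have "[det H = det (hyp3 (H $ 1 $ 3) (H $ 2 $ 2))] (mod p)"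
    by (rule det_cong, rule cong_dvd_modulus[OF cong]) simp
  ultimately have "\<not> p dvd det (hyp3 (H $ 1 $ 3) (H $ 2 $ 2))" by (simp add: cong_dvd_iff)
  then have "\<not> p dvd H $ 1 $ 3" "\<not> p dvd H $ 2 $ 2" by (auto simp: hyp3_def det_3)
  then show thesis by (rule that[OF QH _ _ cong])
qed

section \<open>Quaternary forms: splitting off two hyperbolic planes modulo \<open>p\<close>\<close>

definition hyp4 :: "int \<Rightarrow> int \<Rightarrow> int^4^4"
  where "hyp4 a b = vector [vector [0, 0, 0, a], vector [0, 0, b, 0], vector [0, b, 0, 0],
    vector [a, 0, 0, 0]]"

text \<open>The restriction to the first three coordinates is already isotropic modulo
  \<open>p\<close>.\<close>

lemma quaternary_isotropic_basis:
  fixes N :: "int^4^4"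
  assumes p: "prime p" "odd p" and N: "integral_form N"
  obtains G where "int_equivalent N G" "p dvd G $ 1 $ 1"
proof -
  note sym = integral_form_sym[OF N]
  obtain x y z where "p dvd N$1$1 * x\<^sup>2 + N$2$2 * y\<^sup>2 + N$3$3 * z\<^sup>2
      + 2 * N$1$2 * x * y + 2 * N$1$3 * x * z + 2 * N$2$3 * y * z" and 1: "x = 1 \<or> y = 1 \<or> z = 1"
    using ternary_isotropic_mod_prime[OF p] .
  then have iso: "p dvd bilin N (vector [x, y, z, 0]) (vector [x, y, z, 0])"
    by (simp add: bilin_4 sym[of 2 1] sym[of 3 1] sym[of 3 2] power2_eq_square algebra_simps)
  define v :: "int^4" where "v = vector [x, y, z, 0]"
  obtain W :: "int^4^4" where W: "(det W)\<^sup>2 = 1" and W1: "W $ 1 = v"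
    using 1
  proof (elim disjE)
    assume "x = 1"
    then show thesis
      by (intro that[of "vector [v, axis 2 1, axis 3 1, axis 4 1]"])
        (simp_all add: det_4 axis_def v_def)
  next
    assume "y = 1"
    then show thesis
      by (intro that[of "vector [v, axis 1 1, axis 3 1, axis 4 1]"])
        (simp_all add: det_4 axis_def v_def)
  next
    assume "z = 1"
    then show thesis
      by (intro that[of "vector [v, axis 1 1, axis 2 1, axis 4 1]"])
        (simp_all add: det_4 axis_def v_def)
  qed
  obtain G where G: "int_equivalent N G" "\<forall>i j. G $ i $ j = bilin N (W $ i) (W $ j)"
    using int_equivalent_gram[OF W, of N] .
  have "p dvd G $ 1 $ 1" using iso by (simp add: G(2) W1 v_def)
  with G(1) show thesis by (rule that)
qed

lemma quaternary_hyperbolic_basis: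
  fixes N :: "int^4^4"
  assumes p: "prime p" "odd p" and N: "integral_form N" "\<not> p dvd det N"
  obtains G where "int_equivalent N G" "p dvd G $ 1 $ 1" "\<not> p dvd G $ 1 $ 4"
proof -
  obtain G where G: "int_equivalent N G" "p dvd G $ 1 $ 1"
    using quaternary_isotropic_basis[OF p N(1)] .
  have "\<not> p dvd det G" using N(2) int_equivalent_det[OF G(1)] by simp
  then have "\<not> (\<forall>j. p dvd G $ 1 $ j)" using dvd_det_row[of p G 1] by blast
  then obtain j where j: "\<not> p dvd G $ 1 $ j" "j = 2 \<or> j = 3 \<or> j = 4"
    using G(2) by (auto simp: forall_4)
  obtain W :: "int^4^4" where W: "(det W)\<^sup>2 = 1" and W14: "W $ 1 = axis 1 1" "W $ 4 = axis j 1"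
    using j(2)
  proof (elim disjE)
    assume "j = 2"
    then show thesis
      by (intro that[of "vector [axis 1 1, axis 4 1, axis 3 1, axis 2 1]"]) (simp_all add: det_4 axis_def)
  next
    assume "j = 3"
    then show thesis
      by (intro that[of "vector [axis 1 1, axis 2 1, axis 4 1, axis 3 1]"]) (simp_all add: det_4 axis_def)
  next
    assume "j = 4"
    then show thesis
      by (intro that[of "vector [axis 1 1, axis 2 1, axis 3 1, axis 4 1]"]) (simp_all add: det_4 axis_def)
  qed
  obtain H where H: "int_equivalent G H" "\<forall>i j. H $ i $ j = bilin G (W $ i) (W $ j)"
    using int_equivalent_gram[OF W, of G] .
  have "H $ 1 $ 1 = G $ 1 $ 1" "H $ 1 $ 4 = G $ 1 $ j" by (simp_all add: H(2) W14 bilin_axis)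
  then show thesis using that[OF int_equivalent_trans[OF G(1) H(1)]] G(2) j(1) by simp
qed

text \<open>The outer vectors become a hyperbolic plane orthogonal to the two middle ones:
  \<open>t\<close> corrects the norm of the fourth vector, \<open>q\<close> and \<open>r\<close> the
  pairings with the first, \<open>u\<close> and \<open>v\<close> those with the fourth.\<close>

lemma quaternary_split_basis:
  fixes N :: "int^4^4"
  assumes p: "prime p" "odd p" and N: "integral_form N" "\<not> p dvd det N"
  obtains G where "int_equivalent N G" "\<not> p dvd G $ 1 $ 4" "p dvd G $ 1 $ 1" "p dvd G $ 1 $ 2"
    "p dvd G $ 1 $ 3" "p dvd G $ 2 $ 4" "p dvd G $ 3 $ 4" "p dvd G $ 4 $ 4"
proof -
  obtain G where G: "int_equivalent N G" "p dvd G $ 1 $ 1" "\<not> p dvd G $ 1 $ 4"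
    using quaternary_hyperbolic_basis[OF p N] .
  note sym = integral_form_sym[OF int_equivalent_integral_form[OF G(1) N(1)]]
  have cop: "coprime (G $ 1 $ 4) p"
    using p(1) G(3) by (simp add: prime_imp_coprime coprime_commute[of _ p])
  have "coprime 2 p" using p(2) by simp
  with cop have cop2: "coprime (2 * G $ 1 $ 4) p" by simp
  obtain t where t: "p dvd G $ 4 $ 4 + 2 * G $ 1 $ 4 * t" using linear_congruence[OF cop2] .
  obtain q where q: "p dvd G $ 1 $ 2 + G $ 1 $ 4 * q" using linear_congruence[OF cop] .
  obtain r where r: "p dvd G $ 1 $ 3 + G $ 1 $ 4 * r" using linear_congruence[OF cop] .
  obtain u where u: "p dvd G $ 2 $ 4 + t * G $ 1 $ 2 + q * G $ 4 $ 4 + q * t * G $ 1 $ 4 + G $ 1 $ 4 * u"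
    using linear_congruence[OF cop] .
  obtain v where v: "p dvd G $ 3 $ 4 + t * G $ 1 $ 3 + r * G $ 4 $ 4 + r * t * G $ 1 $ 4 + G $ 1 $ 4 * v"
    using linear_congruence[OF cop] .
  define W :: "int^4^4" where "W = vector [vector [1, 0, 0, 0], vector [u, 1, 0, q],
    vector [v, 0, 1, r], vector [t, 0, 0, 1]]"
  have W: "(det W)\<^sup>2 = 1" by (simp add: W_def det_4)
  obtain H where H: "int_equivalent G H" "\<forall>i j. H $ i $ j = bilin G (W $ i) (W $ j)"
    using int_equivalent_gram[OF W, of G] .
  have h11: "H $ 1 $ 1 = G $ 1 $ 1"
    and h12: "H $ 1 $ 2 = (G $ 1 $ 2 + G $ 1 $ 4 * q) + u * G $ 1 $ 1"
    and h13: "H $ 1 $ 3 = (G $ 1 $ 3 + G $ 1 $ 4 * r) + v * G $ 1 $ 1"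
    and h14: "H $ 1 $ 4 = G $ 1 $ 4 + t * G $ 1 $ 1"
    and h24: "H $ 2 $ 4 = (G $ 2 $ 4 + t * G $ 1 $ 2 + q * G $ 4 $ 4 + q * t * G $ 1 $ 4 + G $ 1 $ 4 * u)
        + u * t * G $ 1 $ 1"
    and h34: "H $ 3 $ 4 = (G $ 3 $ 4 + t * G $ 1 $ 3 + r * G $ 4 $ 4 + r * t * G $ 1 $ 4 + G $ 1 $ 4 * v)
        + v * t * G $ 1 $ 1"
    and h44: "H $ 4 $ 4 = (G $ 4 $ 4 + 2 * G $ 1 $ 4 * t) + t\<^sup>2 * G $ 1 $ 1"
    by (simp_all add: H(2) W_def bilin_4 sym[of 2 1] sym[of 3 1] sym[of 4 1] sym[of 4 2] sym[of 4 3]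
        power2_eq_square algebra_simps)
  show thesis
  proof (rule that[OF int_equivalent_trans[OF G(1) H(1)]])
    show "\<not> p dvd H $ 1 $ 4" unfolding h14 using G by (simp add: dvd_add_left_iff)
    show "p dvd H $ 1 $ 1" "p dvd H $ 1 $ 2" "p dvd H $ 1 $ 3" "p dvd H $ 2 $ 4" "p dvd H $ 3 $ 4"
      "p dvd H $ 4 $ 4"
      unfolding h11 h12 h13 h24 h34 h44 using G(2) t q r u v by (auto intro!: dvd_add)
  qed
qed

text \<open>Quadratic formula: \<open>x\<close> is the root \<open>(d - v) / u\<close> modulo
  \<open>p\<close>.\<close>

lemma binary_isotropic_of_square_disc:
  fixes p u v w d :: int
  assumes p: "prime p" and disc: "[v\<^sup>2 - u * w = d\<^sup>2] (mod p)" and u: "\<not> p dvd u"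
  obtains x where "p dvd u * x\<^sup>2 + 2 * v * x + w"
proof -
  have "coprime u p" using p u by (simp add: prime_imp_coprime coprime_commute[of _ p])
  then obtain x where x: "p dvd (v - d) + u * x" by (rule linear_congruence)
  have "u * (u * x\<^sup>2 + 2 * v * x + w) = ((v - d) + u * x) * (v + d + u * x) - (v\<^sup>2 - u * w - d\<^sup>2)"
    by (simp add: power2_eq_square algebra_simps)
  moreover have "p dvd v\<^sup>2 - u * w - d\<^sup>2" using disc by (simp add: cong_iff_dvd_diff)
  ultimately have "p dvd u * (u * x\<^sup>2 + 2 * v * x + w)" using x by (simp add: dvd_diff)
  then show thesis using that u p prime_dvd_multD by blast
qed

text \<open>Modulo \<open>p\<close> the determinant is \<open>a^2\<close> times the discriminant
  \<open>v^2 - u w\<close> of the middle plane. A square determinant therefore makes this plane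
  isotropic, and being nonsingular it is hyperbolic.\<close>

lemma quaternary_normal_form:
  fixes N :: "int^4^4"
  assumes p: "prime p" "odd p" and N: "integral_form N" "\<not> p dvd det N"
    and disc: "[det N = d\<^sup>2] (mod p)"
  obtains G a b where "int_equivalent N G" "\<not> p dvd a" "\<not> p dvd b"
    "\<And>i j. [G $ i $ j = hyp4 a b $ i $ j] (mod p)"
proof -
  obtain G where G: "int_equivalent N G" "\<not> p dvd G $ 1 $ 4" "p dvd G $ 1 $ 1" "p dvd G $ 1 $ 2"
    "p dvd G $ 1 $ 3" "p dvd G $ 2 $ 4" "p dvd G $ 3 $ 4" "p dvd G $ 4 $ 4"
    using quaternary_split_basis[OF p N] .
  note sym = integral_form_sym[OF int_equivalent_integral_form[OF G(1) N(1)]]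
  define a u v w where "a = G $ 1 $ 4" and "u = G $ 2 $ 2" and "v = G $ 2 $ 3" and "w = G $ 3 $ 3"
  have detG: "[det G = a\<^sup>2 * (v\<^sup>2 - u * w)] (mod p)"
  proof -
    define K :: "int^4^4" where "K = vector [vector [0, 0, 0, a], vector [0, u, v, 0],
      vector [0, v, w, 0], vector [a, 0, 0, 0]]"
    have "[G $ i $ j = K $ i $ j] (mod p)" for i j
      using exhaust_4[of i] exhaust_4[of j] G sym[of 2 1] sym[of 3 1] sym[of 3 2] sym[of 4 1]
        sym[of 4 2] sym[of 4 3]
      by (auto simp: K_def cong_0_iff a_def u_def v_def w_def)
    then have "[det G = det K] (mod p)" by (rule det_cong)
    also have "det K = a\<^sup>2 * (v\<^sup>2 - u * w)"
      by (simp add: K_def det_4 power2_eq_square algebra_simps)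
    finally show ?thesis .
  qed
  have "coprime a p" using p(1) G(2) by (simp add: a_def prime_imp_coprime coprime_commute[of _ p])
  then obtain a' where a': "[a * a' = 1] (mod p)" using cong_solve_coprime_int by blast
  have "[a\<^sup>2 * (v\<^sup>2 - u * w) = d\<^sup>2] (mod p)"
    using detG disc int_equivalent_det[OF G(1)] by (metis cong_sym cong_trans)
  then have "[a'\<^sup>2 * (a\<^sup>2 * (v\<^sup>2 - u * w)) = a'\<^sup>2 * d\<^sup>2] (mod p)" by (rule cong_scalar_left)
  moreover have "[(a * a')\<^sup>2 * (v\<^sup>2 - u * w) = 1\<^sup>2 * (v\<^sup>2 - u * w)] (mod p)"
    using a' by (intro cong_mult cong_pow cong_refl)
  ultimately have disc': "[v\<^sup>2 - u * w = (a' * d)\<^sup>2] (mod p)"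
    by (simp add: power_mult_distrib mult_ac) (metis cong_sym cong_trans)
  have unit: "\<not> p dvd v\<^sup>2 - u * w"
  proof
    assume "p dvd v\<^sup>2 - u * w"
    then have "p dvd det G" using detG by (simp add: cong_dvd_iff)
    then show False using N(2) int_equivalent_det[OF G(1)] by simp
  qed
  obtain H where H: "int_equivalent G H" "\<not> p dvd H $ 1 $ 4" "p dvd H $ 1 $ 1" "p dvd H $ 1 $ 2"
    "p dvd H $ 1 $ 3" "p dvd H $ 2 $ 4" "p dvd H $ 3 $ 4" "p dvd H $ 4 $ 4"
    "p dvd H $ 2 $ 2" "\<not> p dvd H $ 2 $ 3"
  proof (cases "p dvd u")
    case True
    have "\<not> p dvd v" using unit True by (auto simp: power2_eq_square)
    then show thesis using G True
      by (intro that[OF int_equivalent_refl]) (simp_all add: u_def v_def)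
  next
    case False
    obtain x where x: "p dvd u * x\<^sup>2 + 2 * v * x + w"
      using binary_isotropic_of_square_disc[OF p(1) disc' False] .
    \<comment> \<open>The root \<open>x\<close> gives the isotropic vector \<open>(x, 1)\<close> of
      the middle plane as the new second vector; the old second vector becomes the third.\<close>
    define W :: "int^4^4" where "W = vector [vector [1, 0, 0, 0], vector [0, x, 1, 0],
      vector [0, 1, 0, 0], vector [0, 0, 0, 1]]"
    have W: "(det W)\<^sup>2 = 1" by (simp add: W_def det_4)
    obtain H where H: "int_equivalent G H" "\<forall>i j. H $ i $ j = bilin G (W $ i) (W $ j)"
    using int_equivalent_gram[OF W, of G] .
    have h: "H $ 1 $ 1 = G $ 1 $ 1" "H $ 1 $ 2 = x * G $ 1 $ 2 + G $ 1 $ 3" "H $ 1 $ 3 = G $ 1 $ 2"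
      "H $ 1 $ 4 = G $ 1 $ 4" "H $ 2 $ 4 = x * G $ 2 $ 4 + G $ 3 $ 4" "H $ 3 $ 4 = G $ 2 $ 4"
      "H $ 4 $ 4 = G $ 4 $ 4" "H $ 2 $ 2 = u * x\<^sup>2 + 2 * v * x + w" "H $ 2 $ 3 = u * x + v"
      by (simp_all add: H(2) W_def bilin_4 sym[of 3 2] u_def v_def w_def power2_eq_square
          algebra_simps)
    \<comment> \<open>The discriminant is the square of the new middle pairing modulo
      \<open>p\<close>, so that pairing is a unit.\<close>
    have "v\<^sup>2 - u * w = (u * x + v) * (u * x + v) - u * (u * x\<^sup>2 + 2 * v * x + w)"
      by (simp add: power2_eq_square algebra_simps)
    then have "\<not> p dvd u * x + v"
      using unit dvd_diff[OF dvd_mult[of p "u * x + v" "u * x + v"] dvd_mult[OF x]] by metis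
    moreover have "p dvd x * G $ 1 $ 2 + G $ 1 $ 3" "p dvd x * G $ 2 $ 4 + G $ 3 $ 4"
      using G by (simp_all add: dvd_add)
    ultimately show thesis using G x by (intro that[OF H(1)]) (simp_all only: h not_False_eq_True)
  qed
  have NH: "int_equivalent N H" by (rule int_equivalent_trans[OF G(1) H(1)])
  note symH = integral_form_sym[OF int_equivalent_integral_form[OF NH N(1)]]
  have "coprime (H $ 2 $ 3) p"
    using p(1) H by (simp add: prime_imp_coprime coprime_commute[of _ p])
  moreover have "coprime 2 p" using p(2) by simp
  ultimately have "coprime (2 * H $ 2 $ 3) p" by simp
  \<comment> \<open>Adding \<open>t\<close> times the isotropic second vector makes the third
    isotropic too.\<close>
  then obtain t where t: "p dvd H $ 3 $ 3 + 2 * H $ 2 $ 3 * t" by (rule linear_congruence)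
  define W :: "int^4^4" where "W = vector [vector [1, 0, 0, 0], vector [0, 1, 0, 0],
      vector [0, t, 1, 0], vector [0, 0, 0, 1]]"
  have W: "(det W)\<^sup>2 = 1" by (simp add: W_def det_4)
  obtain K where K: "int_equivalent H K" "\<forall>i j. K $ i $ j = bilin H (W $ i) (W $ j)"
    using int_equivalent_gram[OF W, of H] .
  have k: "K $ 1 $ 1 = H $ 1 $ 1" "K $ 1 $ 2 = H $ 1 $ 2" "K $ 1 $ 3 = t * H $ 1 $ 2 + H $ 1 $ 3"
      "K $ 1 $ 4 = H $ 1 $ 4" "K $ 2 $ 4 = H $ 2 $ 4" "K $ 3 $ 4 = t * H $ 2 $ 4 + H $ 3 $ 4"
      "K $ 4 $ 4 = H $ 4 $ 4" "K $ 2 $ 2 = H $ 2 $ 2" "K $ 2 $ 3 = H $ 2 $ 3 + t * H $ 2 $ 2"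
      "K $ 3 $ 3 = (H $ 3 $ 3 + 2 * H $ 2 $ 3 * t) + t\<^sup>2 * H $ 2 $ 2"
    by (simp_all add: K(2) W_def bilin_4 symH[of 3 2] power2_eq_square algebra_simps)
  have NK: "int_equivalent N K" by (rule int_equivalent_trans[OF NH K(1)])
  note symK = integral_form_sym[OF int_equivalent_integral_form[OF NK N(1)]]
  have d: "p dvd K $ 1 $ 1" "p dvd K $ 1 $ 2" "p dvd K $ 1 $ 3" "p dvd K $ 2 $ 4" "p dvd K $ 3 $ 4"
      "p dvd K $ 4 $ 4" "p dvd K $ 2 $ 2" "p dvd K $ 3 $ 3"
    unfolding k using H t by (auto intro!: dvd_add)
  have cong: "[K $ i $ j = hyp4 (K $ 1 $ 4) (K $ 2 $ 3) $ i $ j] (mod p)" for i j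
    using exhaust_4[of i] exhaust_4[of j] d symK[of 2 1] symK[of 3 1] symK[of 3 2] symK[of 4 1]
      symK[of 4 2] symK[of 4 3]
    by (auto simp: hyp4_def cong_0_iff)
  have "\<not> p dvd K $ 1 $ 4" "\<not> p dvd K $ 2 $ 3"
    unfolding k using H by (simp_all add: dvd_add_left_iff)
  then show thesis by (rule that[OF NK _ _ cong])
qed

section \<open>Primitive self-dual lattices in dimension 3\<close>

lemma bilin_cong:
  fixes F G :: "int^'m^'m"
  assumes "\<And>i j. [F $ i $ j = G $ i $ j] (mod k)"
  shows "[bilin F x y = bilin G x y] (mod k)"
  unfolding bilin_def by (intro cong_sum cong_mult cong_refl assms)

lemma sublattices_rowsI:
  fixes F W :: "int^'m^'m"
  assumes "L = range ((*v) (transpose W))" "(det W)\<^sup>2 = k ^ CARD('m)"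
    "\<And>i j. k dvd bilin F (W $ i) (W $ j)"
  shows "L \<in> sublattices k F"
proof -
  have W: "transpose W *v axis i 1 = W $ i" for i
    unfolding mult_axis by (simp add: row_def vec_eq_iff)
  have "(transpose (transpose W) ** F ** transpose W) $ i $ j = bilin F (W $ i) (W $ j)" for i j
    unfolding bilin_axis[symmetric] bilin_mult_mult[symmetric] W by (rule refl)
  then show ?thesis unfolding sublattices_def
    using assms by (intro CollectI exI[of _ "transpose W"] conjI allI) simp_all
qed

text \<open>
  The lattice of the isotropic line spanned by \<open>v = (1, 2 a t, - 2 a b t\<^sup>2)\<close>: it consists of the
  vectors that are orthogonal to \<open>v\<close> modulo \<open>p\<^sup>2\<close> and multiples of \<open>v\<close> modulo \<open>p\<close>. It depends only on
  \<open>t\<close> modulo \<open>p\<close>.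
\<close>

definition lat3 :: "int \<Rightarrow> int \<Rightarrow> int \<Rightarrow> int \<Rightarrow> (int^3) set"
  where "lat3 p a b t = {x. p dvd x$2 - 2 * a * t * x$1
    \<and> p\<^sup>2 dvd x$3 + 2 * b * t * x$2 - 2 * a * b * t\<^sup>2 * x$1}"

text \<open>The lattice of the isotropic line spanned by \<open>(0, 0, 1)\<close>, the point of the
  conic that the parameter \<open>t\<close> misses.\<close>

definition lat3_inf :: "int \<Rightarrow> (int^3) set"
  where "lat3_inf p = {x. p\<^sup>2 dvd x$1 \<and> p dvd x$2}"

lemma bilin_hyp3: "bilin (hyp3 a b) x y = a * (x$1 * y$3 + x$3 * y$1) + b * (x$2 * y$2)"
  by (simp add: bilin_3 hyp3_def algebra_simps)

lemma dvd_bilin_hyp3_iff: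
  assumes "\<And>i j. [G $ i $ j = hyp3 a b $ i $ j] (mod k)"
  shows "k dvd bilin G x y \<longleftrightarrow> k dvd a * (x$1 * y$3 + x$3 * y$1) + b * (x$2 * y$2)"
  using cong_dvd_iff[OF bilin_cong[OF assms]] by (simp only: bilin_hyp3)

lemma transpose_mult_vec: "(transpose W *v y) $ j = (\<Sum>i\<in>UNIV. y $ i * W $ i $ j)"
  for W :: "int^'n^'m"
  by (simp add: vector_matrix_mult_def mult.commute)

lemma lat3_mem_sublattices:
  assumes G: "\<And>i j. [G $ i $ j = hyp3 a b $ i $ j] (mod p\<^sup>2)"
  shows "lat3 p a b t \<in> sublattices (p\<^sup>2) G"
proof -
  \<comment> \<open>The isotropic vector, \<open>p\<close> times a vector orthogonal to it, and
    \<open>p^2\<close> times a unit vector; the index is \<open>p^3\<close>.\<close>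
  define W :: "int^3^3" where "W = vector [vector [1, 2 * a * t, - 2 * a * b * t\<^sup>2],
    vector [0, p, - 2 * b * t * p], vector [0, 0, p\<^sup>2]]"
  show ?thesis
  proof (rule sublattices_rowsI)
    show "lat3 p a b t = range ((*v) (transpose W))"
    proof (intro equalityI subsetI)
      fix x assume "x \<in> lat3 p a b t"
      then obtain c d where c: "x$2 - 2 * a * t * x$1 = p * c"
        and d: "x$3 + 2 * b * t * x$2 - 2 * a * b * t\<^sup>2 * x$1 = p\<^sup>2 * d"
        unfolding lat3_def by (auto elim!: dvdE)
      have x2: "x$2 = 2 * a * t * x$1 + p * c" using c by simp
      have x3: "x$3 = p\<^sup>2 * d - 2 * b * t * x$2 + 2 * a * b * t\<^sup>2 * x$1" using d by simp
      have "x = transpose W *v vector [x$1, c, d]"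
        unfolding vec_eq_iff forall_3
        by (simp add: transpose_mult_vec sum_3 W_def x2 x3 power2_eq_square algebra_simps
            del: transpose_matrix_vector)
      then show "x \<in> range ((*v) (transpose W))" by (rule range_eqI)
    next
      fix x assume "x \<in> range ((*v) (transpose W))"
      then obtain y where x: "x = transpose W *v y" by (rule rangeE)
      have x1: "x$1 = y$1" and x2: "x$2 = 2 * a * t * y$1 + p * y$2"
        and x3: "x$3 = - 2 * a * b * t\<^sup>2 * y$1 - 2 * b * t * p * y$2 + p\<^sup>2 * y$3"
        unfolding x by (simp_all add: transpose_mult_vec sum_3 W_def algebra_simps
            del: transpose_matrix_vector)
      have "x$2 - 2 * a * t * x$1 = p * y$2"
        "x$3 + 2 * b * t * x$2 - 2 * a * b * t\<^sup>2 * x$1 = p\<^sup>2 * y$3"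
        unfolding x1 x2 x3 by (simp_all add: power2_eq_square algebra_simps)
      then show "x \<in> lat3 p a b t" by (simp add: lat3_def)
    qed
    show "(det W)\<^sup>2 = (p\<^sup>2) ^ CARD(3)" by (simp add: W_def det_3 power_mult_distrib flip: power_mult)
    have "\<forall>i j. p\<^sup>2 dvd bilin G (W $ i) (W $ j)"
      unfolding forall_3 dvd_bilin_hyp3_iff[OF G] W_def
      by (simp add: power2_eq_square algebra_simps)
    then show "p\<^sup>2 dvd bilin G (W $ i) (W $ j)" for i j by blast
  qed
qed

lemma lat3_inf_mem_sublattices:
  assumes G: "\<And>i j. [G $ i $ j = hyp3 a b $ i $ j] (mod p\<^sup>2)"
  shows "lat3_inf p \<in> sublattices (p\<^sup>2) G"
proof -
  define W :: "int^3^3" where "W = vector [vector [p\<^sup>2, 0, 0], vector [0, p, 0], vector [0, 0, 1]]"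
  show ?thesis
  proof (rule sublattices_rowsI)
    show "lat3_inf p = range ((*v) (transpose W))"
    proof (intro equalityI subsetI)
      fix x assume "x \<in> lat3_inf p"
      then obtain c d where c: "x$1 = p\<^sup>2 * c" and d: "x$2 = p * d"
        unfolding lat3_inf_def by (auto elim!: dvdE)
      have "x = transpose W *v vector [c, d, x$3]"
        unfolding vec_eq_iff forall_3
        by (simp add: transpose_mult_vec sum_3 W_def c d del: transpose_matrix_vector)
      then show "x \<in> range ((*v) (transpose W))" by (rule range_eqI)
    next
      fix x assume "x \<in> range ((*v) (transpose W))"
      then obtain y where x: "x = transpose W *v y" by (rule rangeE)
      show "x \<in> lat3_inf p"
        unfolding x by (simp add: lat3_inf_def transpose_mult_vec sum_3 W_def del: transpose_matrix_vector)
    qed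
    show "(det W)\<^sup>2 = (p\<^sup>2) ^ CARD(3)" by (simp add: W_def det_3 power_mult_distrib flip: power_mult)
    have "\<forall>i j. p\<^sup>2 dvd bilin G (W $ i) (W $ j)"
      unfolding forall_3 dvd_bilin_hyp3_iff[OF G] W_def
      by (simp add: power2_eq_square algebra_simps)
    then show "p\<^sup>2 dvd bilin G (W $ i) (W $ j)" for i j by blast
  qed
qed

lemma prime_square_dvd_unit_mult:
  fixes p c x :: int
  assumes "prime p" "\<not> p dvd c" "p\<^sup>2 dvd c * x"
  shows "p\<^sup>2 dvd x"
proof -
  have "coprime (p\<^sup>2) c" using assms(1,2) by (simp add: prime_imp_coprime)
  then show ?thesis using assms(3) by (simp add: coprime_dvd_mult_right_iff)
qed

text \<open>The change of the condition modulo \<open>p^2\<close> is \<open>p\<close> times a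
  multiple of the expression that the first condition makes divisible by \<open>p\<close>, up to
  multiples of \<open>p^2\<close>.\<close>

lemma lat3_cong:
  assumes "[s = t] (mod p)"
  shows "lat3 p a b s \<subseteq> lat3 p a b t"
proof
  obtain c where c: "t = s + p * c" using assms by (metis cong_iff_lin mult.commute)
  fix x assume "x \<in> lat3 p a b s"
  then have 1: "p dvd x$2 - 2 * a * s * x$1"
    and 2: "p\<^sup>2 dvd x$3 + 2 * b * s * x$2 - 2 * a * b * s\<^sup>2 * x$1" by (simp_all add: lat3_def)
  have eq1: "x$2 - 2 * a * t * x$1 = (x$2 - 2 * a * s * x$1) - p * (2 * a * c * x$1)"
    by (simp add: c algebra_simps)
  have eq2: "x$3 + 2 * b * t * x$2 - 2 * a * b * t\<^sup>2 * x$1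
      = (x$3 + 2 * b * s * x$2 - 2 * a * b * s\<^sup>2 * x$1)
        + (p * (x$2 - 2 * a * s * x$1)) * (2 * b * c) - p\<^sup>2 * (2 * a * b * c\<^sup>2 * x$1)"
    by (simp add: c power2_eq_square algebra_simps)
  have 3: "p\<^sup>2 dvd p * (x$2 - 2 * a * s * x$1)" using 1 by (simp add: power2_eq_square)
  have "p\<^sup>2 dvd x$3 + 2 * b * t * x$2 - 2 * a * b * t\<^sup>2 * x$1"
    unfolding eq2 by (rule dvd_diff[OF dvd_add[OF 2 dvd_mult2[OF 3]] dvd_triv_left])
  moreover have "p dvd x$2 - 2 * a * t * x$1"
    unfolding eq1 by (rule dvd_diff[OF 1 dvd_triv_left])
  ultimately show "x \<in> lat3 p a b t" by (simp add: lat3_def)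
qed

text \<open>The first coordinate decides between the affine points of the conic and the point at
  infinity.\<close>

lemma primitive_self_dual_cases_3:
  assumes p: "prime p" "odd p" and ab: "\<not> p dvd a" "\<not> p dvd b"
    and G: "\<And>i j. [G $ i $ j = hyp3 a b $ i $ j] (mod p\<^sup>2)"
    and L: "self_dual (p\<^sup>2) G L" and prim: "primitive_at p L"
  shows "L \<subseteq> lat3_inf p \<or> (\<exists>t\<in>{0..<p}. L \<subseteq> lat3 p a b t)"
proof -
  have B: "p\<^sup>2 dvd a * (x$1 * y$3 + x$3 * y$1) + b * (x$2 * y$2)" if "x \<in> L" "y \<in> L" for x y
    using self_dual_dvd[OF L that] by (simp only: dvd_bilin_hyp3_iff[OF G])
  have p2: "\<not> p dvd 2"
  proof
    assume "p dvd 2"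
    moreover have "coprime p 2" using p(2) by simp
    ultimately show False using p(1) by (metis coprime_absorb_left not_prime_unit)
  qed
  have sq: "p dvd z" if "p\<^sup>2 dvd z * z \<or> p dvd z * z" for z
  proof -
    have "p dvd z * z" using that by (auto intro: dvd_trans[of p "p\<^sup>2"])
    then show ?thesis using p(1) prime_dvd_multD by blast
  qed
  show ?thesis
  proof (cases "\<exists>v\<in>L. \<not> p dvd v$1")
    case True
    then obtain v where v: "v \<in> L" "\<not> p dvd v$1" by blast
    have u: "\<not> p dvd 2 * a * v$1" using p(1) p2 ab(1) v(2) by (simp add: prime_dvd_mult_iff)
    have "coprime (p\<^sup>2) (2 * a * v$1)"
      unfolding coprime_power_left_iff by (intro disjI1 prime_imp_coprime[OF p(1) u])
    then have "coprime (2 * a * v$1) (p\<^sup>2)" by (simp only: coprime_commute)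
    \<comment> \<open>\<open>t\<close> is chosen so that, by isotropy, \<open>v\<close> is
      \<open>v$1\<close> times \<open>(1, 2 a t, - 2 a b t^2)\<close> modulo \<open>p^2\<close>;
      \<open>d\<close> and \<open>e\<close> measure the deviation in the last two
      coordinates.\<close>
    then obtain t where t: "p\<^sup>2 dvd - (v$2) + 2 * a * v$1 * t" by (rule linear_congruence)
    define d where "d = v$2 - 2 * a * t * v$1"
    have d: "p\<^sup>2 dvd d"
      using t by (subst dvd_minus_iff[symmetric]) (simp add: d_def algebra_simps)
    define e where "e = v$3 + 2 * a * b * t\<^sup>2 * v$1"
    have eq: "a * (v$1 * v$3 + v$3 * v$1) + b * (v$2 * v$2) = 2 * a * v$1 * e + d * (b * (v$2 + 2 * a * t * v$1))"
      by (simp add: d_def e_def power2_eq_square algebra_simps)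
    have "p\<^sup>2 dvd 2 * a * v$1 * e"
      using B[OF v(1) v(1), unfolded eq] d by (simp only: dvd_add_left_iff dvd_mult2)
    then have e: "p\<^sup>2 dvd e" using prime_square_dvd_unit_mult[OF p(1) u] by blast
    have "L \<subseteq> lat3 p a b t"
    proof
      fix x assume x: "x \<in> L"
      \<comment> \<open>Modulo \<open>p^2\<close> this is the pairing of \<open>x\<close> with
        \<open>v\<close>, up to the unit \<open>a * v$1\<close>.\<close>
      define E where "E = x$3 + 2 * b * t * x$2 - 2 * a * b * t\<^sup>2 * x$1"
      have eq: "a * (x$1 * v$3 + x$3 * v$1) + b * (x$2 * v$2)
          = a * v$1 * E + e * (a * x$1) + d * (b * x$2)"
        by (simp add: d_def e_def E_def power2_eq_square algebra_simps)
      have "p\<^sup>2 dvd a * v$1 * E"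
        using B[OF x v(1), unfolded eq] d e by (simp only: dvd_add_left_iff dvd_mult2)
      moreover have "\<not> p dvd a * v$1" using p(1) ab(1) v(2) by (simp add: prime_dvd_mult_iff)
      ultimately have E: "p\<^sup>2 dvd E" by (rule prime_square_dvd_unit_mult[OF p(1), rotated])
      \<comment> \<open>Once \<open>E\<close> vanishes, \<open>x\<close> pairs with itself to
        \<open>b * z^2\<close> modulo \<open>p^2\<close>, which yields divisibility of
        \<open>z\<close> by \<open>p\<close> only; hence the mixed moduli in
        \<open>lat3\<close>.\<close>
      define z where "z = x$2 - 2 * a * t * x$1"
      have eq: "a * (x$1 * x$3 + x$3 * x$1) + b * (x$2 * x$2) = b * (z * z) + E * (2 * a * x$1)"
        by (simp add: E_def z_def power2_eq_square algebra_simps)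
      have "p\<^sup>2 dvd b * (z * z)"
        using B[OF x x, unfolded eq] E by (simp only: dvd_add_left_iff dvd_mult2)
      then have "p\<^sup>2 dvd z * z" by (rule prime_square_dvd_unit_mult[OF p(1) ab(2)])
      then have "p dvd z" by (intro sq disjI1)
      then show "x \<in> lat3 p a b t" using E by (simp only: lat3_def E_def z_def mem_Collect_eq)
    qed
    also have "\<dots> \<subseteq> lat3 p a b (t mod p)" by (rule lat3_cong) (simp add: cong_def)
    finally have "L \<subseteq> lat3 p a b (t mod p)" .
    moreover have "t mod p \<in> {0..<p}" using prime_gt_0_int[OF p(1)] by simp
    ultimately show ?thesis by blast
  next
    case False
    then have d1: "p dvd x$1" if "x \<in> L" for x using that by blast
    have d2: "p dvd x$2" if "x \<in> L" for x
    proof -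
      have "p dvd a * (x$1 * x$3 + x$3 * x$1) + b * (x$2 * x$2)"
        using B[OF that that] by (auto intro: dvd_trans[of p "p\<^sup>2"])
      then have "p dvd b * (x$2 * x$2)" using d1[OF that] by (simp add: dvd_add_right_iff)
      then have "p dvd x$2 * x$2" using ab(2) p(1) prime_dvd_multD by blast
      then show ?thesis using sq by blast
    qed
    have d22: "p\<^sup>2 dvd b * (x$2 * y$2)" if "x \<in> L" "y \<in> L" for x y
      using mult_dvd_mono[OF d2[OF that(1)] d2[OF that(2)]] by (simp add: power2_eq_square)
    \<comment> \<open>Primitivity supplies a vector whose third coordinate is a unit. Pairing with
      it raises divisibility of first coordinates from \<open>p\<close> to \<open>p^2\<close>, since
      products of second coordinates vanish modulo \<open>p^2\<close>.\<close>
    obtain v i where v: "v \<in> L" "\<not> p dvd v$i" using prim unfolding primitive_at_def by blast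
    then have v3: "\<not> p dvd v$3" using d1[OF v(1)] d2[OF v(1)] exhaust_3[of i] by auto
    have eq: "a * (v$1 * v$3 + v$3 * v$1) = (2 * a * v$3) * v$1" by simp
    have "p\<^sup>2 dvd (2 * a * v$3) * v$1"
      using B[OF v(1) v(1)] d22[OF v(1) v(1)] by (simp only: eq dvd_add_left_iff)
    moreover have "\<not> p dvd 2 * a * v$3" using p(1) p2 ab(1) v3 by (simp add: prime_dvd_mult_iff)
    ultimately have v1: "p\<^sup>2 dvd v$1" by (rule prime_square_dvd_unit_mult[OF p(1), rotated])
    have "L \<subseteq> lat3_inf p"
    proof
      fix x assume x: "x \<in> L"
      have "p\<^sup>2 dvd a * (x$1 * v$3 + x$3 * v$1)"
        using B[OF x v(1)] d22[OF x v(1)] by (simp only: dvd_add_left_iff)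
      moreover have "a * (x$1 * v$3 + x$3 * v$1) = (a * v$3) * x$1 + v$1 * (a * x$3)"
        by (simp add: algebra_simps)
      ultimately have "p\<^sup>2 dvd (a * v$3) * x$1" using v1 by (simp add: dvd_add_left_iff)
      moreover have "\<not> p dvd a * v$3" using p(1) ab(1) v3 by (simp add: prime_dvd_mult_iff)
      ultimately have "p\<^sup>2 dvd x$1" by (rule prime_square_dvd_unit_mult[OF p(1), rotated])
      then show "x \<in> lat3_inf p" using d2[OF x] by (simp add: lat3_inf_def)
    qed
    then show ?thesis ..
  qed
qed

lemma primitive_sublattices_3:
  fixes G :: "int^3^3"
  assumes p: "prime p" "odd p" and ab: "\<not> p dvd a" "\<not> p dvd b"
    and G: "\<And>i j. [G $ i $ j = hyp3 a b $ i $ j] (mod p\<^sup>2)"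
    and GI: "integral_form G" "\<not> p dvd det G"
  shows "{L \<in> sublattices (p\<^sup>2) G. primitive_at p L} = insert (lat3_inf p) (lat3 p a b ` {0..<p})"
proof -
  have sd: "self_dual (p\<^sup>2) G L" if "L \<in> sublattices (p\<^sup>2) G" for L
  proof (rule sublattice_self_dual[OF that])
    show "transpose G = G" using GI(1) by (simp add: integral_form_def)
    show "det G \<noteq> 0" using GI(2) by auto
    show "coprime (p\<^sup>2) (det G)"
      unfolding coprime_power_left_iff by (intro disjI1 prime_imp_coprime[OF p(1) GI(2)])
    show "p\<^sup>2 \<noteq> 0" using p(1) by auto
  qed
  have mem: "lat3_inf p \<in> sublattices (p\<^sup>2) G" "\<And>t. lat3 p a b t \<in> sublattices (p\<^sup>2) G"
    by (rule lat3_inf_mem_sublattices[OF G]) (rule lat3_mem_sublattices[OF G])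
  have unit: "\<not> p dvd 1" using p(1) not_prime_unit by blast
  show ?thesis
  proof (intro equalityI subsetI)
    fix L assume "L \<in> {L \<in> sublattices (p\<^sup>2) G. primitive_at p L}"
    then have L: "self_dual (p\<^sup>2) G L" "primitive_at p L" using sd by simp_all
    show "L \<in> insert (lat3_inf p) (lat3 p a b ` {0..<p})"
      using primitive_self_dual_cases_3[OF p ab G L]
    proof (elim disjE bexE)
      assume "L \<subseteq> lat3_inf p"
      then have "L = lat3_inf p" by (rule self_dual_subset_eq[OF L(1) sd[OF mem(1)]])
      then show ?thesis by (rule insertI1[THEN back_subst[of "\<lambda>x. x \<in> _"], OF sym])
    next
      fix t assume t: "t \<in> {0..<p}" "L \<subseteq> lat3 p a b t"
      have "L = lat3 p a b t" by (rule self_dual_subset_eq[OF L(1) sd[OF mem(2)] t(2)])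
      then show ?thesis using t(1) by (intro insertI2 rev_image_eqI)
    qed
  next
    fix L assume "L \<in> insert (lat3_inf p) (lat3 p a b ` {0..<p})"
    then consider "L = lat3_inf p" | t where "L = lat3 p a b t" by blast
    then show "L \<in> {L \<in> sublattices (p\<^sup>2) G. primitive_at p L}"
    proof cases
      case 1
      have "axis 3 1 \<in> lat3_inf p" by (simp add: lat3_inf_def axis_def)
      moreover have "\<not> p dvd axis 3 1 $ (3 :: 3)" using unit by (simp add: axis_def)
      ultimately have "primitive_at p (lat3_inf p)" unfolding primitive_at_def by blast
      then show ?thesis using mem(1) by (simp add: 1)
    next
      case (2 t)
      have "vector [1, 2 * a * t, - 2 * a * b * t\<^sup>2] \<in> lat3 p a b t"
        by (simp add: lat3_def power2_eq_square algebra_simps)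
      moreover have "\<not> p dvd vector [1, 2 * a * t, - 2 * a * b * t\<^sup>2] $ (1 :: 3)"
        using unit by simp
      ultimately have "primitive_at p (lat3 p a b t)" unfolding primitive_at_def by blast
      then show ?thesis using mem(2) by (simp add: 2)
    qed
  qed
qed

lemma eq_if_cong_range: "[s = t] (mod p) \<Longrightarrow> s \<in> {0..<p} \<Longrightarrow> t \<in> {0..<p} \<Longrightarrow> s = t"
  for p :: int
  by (simp add: cong_def)

text \<open>The spanning vector of each line tests membership: its second coordinate recovers
  \<open>t\<close> modulo \<open>p\<close>, and its first coordinate \<open>1\<close> excludes the
  lattice at infinity.\<close>

lemma card_lat3:
  assumes p: "prime p" "odd p" and a: "\<not> p dvd a"
  shows "card (insert (lat3_inf p) (lat3 p a b ` {0..<p})) = nat p + 1"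
proof -
  let ?v = "\<lambda>t. vector [1, 2 * a * t, - 2 * a * b * t\<^sup>2] :: int^3"
  have v: "?v t \<in> lat3 p a b t" for t
    by (simp add: lat3_def power2_eq_square algebra_simps)
  have inj: "inj_on (lat3 p a b) {0..<p}"
  proof (rule inj_onI)
    fix s t assume st: "s \<in> {0..<p}" "t \<in> {0..<p}" and "lat3 p a b s = lat3 p a b t"
    then have "?v s \<in> lat3 p a b t" using v[of s] by simp
    then have "p dvd 2 * (a * (s - t))" by (simp add: lat3_def algebra_simps)
    moreover have "coprime p 2" using p(2) by simp
    ultimately have "p dvd a * (s - t)" by (simp only: coprime_dvd_mult_right_iff)
    then have "p dvd s - t" using p(1) a prime_dvd_multD by blast
    then show "s = t" using eq_if_cong_range[OF _ st] by (simp add: cong_iff_dvd_diff)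
  qed
  have "lat3_inf p \<notin> lat3 p a b ` {0..<p}"
  proof
    assume "lat3_inf p \<in> lat3 p a b ` {0..<p}"
    then obtain t where "lat3_inf p = lat3 p a b t" by (elim imageE)
    then have "?v t \<in> lat3_inf p" using v[of t] by simp
    then have "p\<^sup>2 dvd 1" by (simp add: lat3_inf_def)
    then have "p dvd 1" by (rule dvd_trans[rotated]) simp
    then show False using p(1) not_prime_unit by blast
  qed
  then show ?thesis by (simp add: card_image[OF inj])
qed

lemma primitive_sublattices_equivalent:
  fixes F G :: "int^'m^'m"
  assumes "int_equivalent F G"
  shows "\<exists>f. bij_betw f {L \<in> sublattices k G. primitive_at p L} {L \<in> sublattices k F. primitive_at p L}"
proof -
  obtain f where f: "bij_betw f (sublattices k G) (sublattices k F)"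
    "\<forall>p L. primitive_at p (f L) \<longleftrightarrow> primitive_at p L"
    using sublattices_equivalent[OF assms, of k] .
  have "bij_betw f {L \<in> sublattices k G. primitive_at p L} {L \<in> sublattices k F. primitive_at p L}"
    unfolding bij_betw_def
  proof
    show "inj_on f {L \<in> sublattices k G. primitive_at p L}"
      using f(1) unfolding bij_betw_def by (auto intro: inj_on_subset)
    have "f ` sublattices k G = sublattices k F" using f(1) by (rule bij_betw_imp_surj_on)
    then have "{L \<in> sublattices k F. primitive_at p L} = {L \<in> f ` sublattices k G. primitive_at p L}"
      by simp
    also have "\<dots> = f ` {L \<in> sublattices k G. primitive_at p (f L)}" by blast
    finally show "f ` {L \<in> sublattices k G. primitive_at p L} = {L \<in> sublattices k F. primitive_at p L}"
      using f(2) by simp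
  qed
  then show ?thesis by (intro exI[of _ f])
qed

lemma card_primitive_sublattices_3:
  fixes Q :: "int^3^3"
  assumes p: "prime p" "odd p" and Q: "integral_form Q" "\<not> p dvd det Q"
  shows "card {L \<in> sublattices (p\<^sup>2) Q. primitive_at p L} = nat p + 1"
    and "finite {L \<in> sublattices (p\<^sup>2) Q. primitive_at p L}"
proof -
  obtain G a b where G: "int_equivalent Q G" and ab: "\<not> p dvd a" "\<not> p dvd b"
    and c: "\<And>i j. [G $ i $ j = hyp3 a b $ i $ j] (mod p\<^sup>2)"
    using ternary_normal_form[OF p Q] by metis
  have "integral_form G" "\<not> p dvd det G"
    using int_equivalent_integral_form[OF G Q(1)] int_equivalent_det[OF G] Q(2) by simp_all
  note eq = primitive_sublattices_3[OF p ab c this]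
  have card: "card {L \<in> sublattices (p\<^sup>2) G. primitive_at p L} = nat p + 1"
    unfolding eq by (rule card_lat3[OF p ab(1)])
  obtain f where f: "bij_betw f {L \<in> sublattices (p\<^sup>2) G. primitive_at p L}
      {L \<in> sublattices (p\<^sup>2) Q. primitive_at p L}"
    using primitive_sublattices_equivalent[OF G] by blast
  show "card {L \<in> sublattices (p\<^sup>2) Q. primitive_at p L} = nat p + 1"
    using bij_betw_same_card[OF f] card by simp
  then show "finite {L \<in> sublattices (p\<^sup>2) Q. primitive_at p L}"
    by (intro card_ge_0_finite) simp
qed

section \<open>Self-dual lattices in dimension 4\<close>

text \<open>
  For \<open>(i, j) = (2, 3)\<close> and \<open>(i, j) = (3, 2)\<close> these are the two rulings of the quadric
  \<open>a x\<^sub>1 x\<^sub>4 + b x\<^sub>2 x\<^sub>3 = 0\<close>.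
\<close>

definition lat4 :: "int \<Rightarrow> int \<Rightarrow> int \<Rightarrow> 4 \<Rightarrow> 4 \<Rightarrow> int \<Rightarrow> (int^4) set"
  where "lat4 p a b i j s = {x. p dvd x$1 + b * s * x$i \<and> p dvd x$j - a * s * x$4}"

text \<open>The member of a ruling at infinite \<open>s\<close>: dividing the two congruences of
  \<open>lat4\<close> by \<open>s\<close> leaves only \<open>x$i\<close> and
  \<open>x$4\<close>.\<close>

definition lat4_inf :: "int \<Rightarrow> 4 \<Rightarrow> (int^4) set"
  where "lat4_inf p i = {x. p dvd x$i \<and> p dvd x$4}"

text \<open>Swapping coordinates \<open>2\<close> and \<open>3\<close> preserves the form and
  exchanges the rulings; this predicate lets one argument serve both.\<close>

definition middle :: "4 \<Rightarrow> 4 \<Rightarrow> bool"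
  where "middle i j \<longleftrightarrow> i = 2 \<and> j = 3 \<or> i = 3 \<and> j = 2"

lemma middle_neq: "middle i j \<Longrightarrow> i \<noteq> 1 \<and> i \<noteq> 4 \<and> j \<noteq> 1 \<and> j \<noteq> 4 \<and> i \<noteq> j"
  by (auto simp: middle_def)

lemma forall_middle: "middle i j \<Longrightarrow> (\<forall>k. P k) \<longleftrightarrow> P 1 \<and> P i \<and> P j \<and> P 4"
  by (auto simp: middle_def forall_4)

lemma dvd_bilin_hyp4_iff:
  assumes G: "\<And>i j. [G $ i $ j = hyp4 a b $ i $ j] (mod k)" and ij: "middle i j"
  shows "k dvd bilin G x y \<longleftrightarrow> k dvd a * (x$1 * y$4 + x$4 * y$1) + b * (x$i * y$j + x$j * y$i)"
proof -
  have "bilin (hyp4 a b) x y = a * (x$1 * y$4 + x$4 * y$1) + b * (x$i * y$j + x$j * y$i)"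
    using ij by (elim disjE conjE middle_def[THEN iffD1, elim_format])
      (simp_all add: bilin_4 hyp4_def algebra_simps)
  then show ?thesis using cong_dvd_iff[OF bilin_cong[OF G]] by simp
qed

lemma lat4_mem_sublattices:
  assumes G: "\<And>i j. [G $ i $ j = hyp4 a b $ i $ j] (mod p)" and ij: "middle i j"
  shows "lat4 p a b i j s \<in> sublattices p G"
proof -
  \<comment> \<open>Coordinates \<open>i\<close> and \<open>4\<close> are free and determine the
    others modulo \<open>p\<close>; the last two rows supply the multiples of
    \<open>p\<close>.\<close>
  define W :: "int^4^4" where "W = vector [\<chi> k. if k = 1 then - b * s else if k = i then 1 else 0,
    \<chi> k. if k = j then a * s else if k = 4 then 1 else 0,
    \<chi> k. if k = 1 then p else 0, \<chi> k. if k = j then p else 0]"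
  note neq = middle_neq[OF ij]
  have W: "(transpose W *v y) $ k = y$1 * W$1$k + y$2 * W$2$k + y$3 * W$3$k + y$4 * W$4$k" for y k
    by (simp only: transpose_mult_vec sum_4)
  have W1: "(transpose W *v y) $ 1 = - b * s * y$1 + p * y$3"
    and Wi: "(transpose W *v y) $ i = y$1"
    and Wj: "(transpose W *v y) $ j = a * s * y$2 + p * y$4"
    and W4: "(transpose W *v y) $ 4 = y$2" for y
    unfolding W using neq by (auto simp: W_def)
  show ?thesis
  proof (rule sublattices_rowsI)
    show "lat4 p a b i j s = range ((*v) (transpose W))"
    proof (intro equalityI subsetI)
      fix x assume "x \<in> lat4 p a b i j s"
      then obtain c d where c: "x$1 + b * s * x$i = p * c" and d: "x$j - a * s * x$4 = p * d"
        unfolding lat4_def by (auto elim!: dvdE)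
      have "x = transpose W *v vector [x$i, x$4, c, d]"
        unfolding vec_eq_iff forall_middle[OF ij] W1 Wi Wj W4
        using c d by (simp add: algebra_simps)
      then show "x \<in> range ((*v) (transpose W))" by (rule range_eqI)
    next
      fix x assume "x \<in> range ((*v) (transpose W))"
      then obtain y where x: "x = transpose W *v y" by (rule rangeE)
      show "x \<in> lat4 p a b i j s"
        unfolding x lat4_def mem_Collect_eq W1 Wi Wj W4 by simp
    qed
    have "det W = p\<^sup>2 \<or> det W = - (p\<^sup>2)"
      using ij unfolding middle_def
      by (elim disjE conjE) (simp_all add: W_def det_4 power2_eq_square)
    then show "(det W)\<^sup>2 = p ^ CARD(4)" by (auto simp flip: power_mult)
    have "\<forall>k l. p dvd bilin G (W $ k) (W $ l)"
      unfolding forall_4 dvd_bilin_hyp4_iff[OF G ij] W_def using neq by auto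
    then show "p dvd bilin G (W $ k) (W $ l)" for k l by blast
  qed
qed

lemma lat4_inf_mem_sublattices:
  assumes G: "\<And>i j. [G $ i $ j = hyp4 a b $ i $ j] (mod p)" and ij: "middle i j"
  shows "lat4_inf p i \<in> sublattices p G"
proof -
  define W :: "int^4^4" where "W = vector [axis 1 1, axis j 1,
    \<chi> k. if k = i then p else 0, \<chi> k. if k = 4 then p else 0]"
  note neq = middle_neq[OF ij]
  have W: "(transpose W *v y) $ k = y$1 * W$1$k + y$2 * W$2$k + y$3 * W$3$k + y$4 * W$4$k" for y k
    by (simp only: transpose_mult_vec sum_4)
  have W1: "(transpose W *v y) $ 1 = y$1" and Wi: "(transpose W *v y) $ i = p * y$3"
    and Wj: "(transpose W *v y) $ j = y$2" and W4: "(transpose W *v y) $ 4 = p * y$4" for y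
    unfolding W using neq by (auto simp: W_def axis_def)
  show ?thesis
  proof (rule sublattices_rowsI)
    show "lat4_inf p i = range ((*v) (transpose W))"
    proof (intro equalityI subsetI)
      fix x assume "x \<in> lat4_inf p i"
      then obtain c d where c: "x$i = p * c" and d: "x$4 = p * d"
        unfolding lat4_inf_def by (auto elim!: dvdE)
      have "x = transpose W *v vector [x$1, x$j, c, d]"
        unfolding vec_eq_iff forall_middle[OF ij] W1 Wi Wj W4 using c d by simp
      then show "x \<in> range ((*v) (transpose W))" by (rule range_eqI)
    next
      fix x assume "x \<in> range ((*v) (transpose W))"
      then obtain y where x: "x = transpose W *v y" by (rule rangeE)
      show "x \<in> lat4_inf p i"
        unfolding x lat4_inf_def mem_Collect_eq Wi W4 by simp
    qed
    have "det W = p\<^sup>2 \<or> det W = - (p\<^sup>2)"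
      using ij unfolding middle_def
      by (elim disjE conjE) (simp_all add: W_def det_4 axis_def power2_eq_square)
    then show "(det W)\<^sup>2 = p ^ CARD(4)" by (auto simp flip: power_mult)
    have "\<forall>k l. p dvd bilin G (W $ k) (W $ l)"
      unfolding forall_4 dvd_bilin_hyp4_iff[OF G ij] W_def using neq by (auto simp: axis_def)
    then show "p dvd bilin G (W $ k) (W $ l)" for k l by blast
  qed
qed

lemma lat4_cong:
  assumes "[s = t] (mod p)"
  shows "lat4 p a b i j s \<subseteq> lat4 p a b i j t"
proof
  obtain c where c: "t = s + p * c" using assms by (metis cong_iff_lin mult.commute)
  fix x assume "x \<in> lat4 p a b i j s"
  then have 1: "p dvd x$1 + b * s * x$i" and 2: "p dvd x$j - a * s * x$4"
    by (simp_all add: lat4_def)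
  have eq1: "x$1 + b * t * x$i = (x$1 + b * s * x$i) + p * (b * c * x$i)"
    and eq2: "x$j - a * t * x$4 = (x$j - a * s * x$4) - p * (a * c * x$4)"
    by (simp_all add: c algebra_simps)
  have "p dvd x$1 + b * t * x$i" unfolding eq1 by (rule dvd_add[OF 1 dvd_triv_left])
  moreover have "p dvd x$j - a * t * x$4" unfolding eq2 by (rule dvd_diff[OF 2 dvd_triv_left])
  ultimately show "x \<in> lat4 p a b i j t" by (simp add: lat4_def)
qed

text \<open>Hypothesis \<open>all\<close> says that every \<open>y\<close> has the same ratio of
  coordinates \<open>j\<close> and \<open>4\<close> as \<open>x\<close>, which is
  \<open>a s\<close>. Isotropy of \<open>x\<close> then fixes its first coordinate, and
  orthogonality to \<open>x\<close> fixes that of \<open>y\<close>.\<close>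

lemma self_dual_subset_lat4:
  assumes p: "prime p" and ab: "\<not> p dvd a" "\<not> p dvd b"
    and B: "\<And>x y. x \<in> L \<Longrightarrow> y \<in> L \<Longrightarrow> p dvd a * (x$1 * y$4 + x$4 * y$1) + b * (x$i * y$j + x$j * y$i)"
    and odd: "odd p"
    and x: "x \<in> L" "\<not> p dvd x$4" "p dvd x$j - a * s * x$4"
    and all: "\<And>y. y \<in> L \<Longrightarrow> p dvd x$4 * y$j - y$4 * x$j"
  shows "L \<subseteq> lat4 p a b i j s"
proof
  fix y assume y: "y \<in> L"
  define d e where "d = x$j - a * s * x$4" and "e = y$j - a * s * y$4"
  have d: "p dvd d" using x(3) by (simp add: d_def)
  have ax4: "\<not> p dvd a * x$4" using p ab x(2) prime_dvd_multD by blast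
  have "x$4 * e = (x$4 * y$j - y$4 * x$j) + d * y$4" by (simp add: d_def e_def algebra_simps)
  then have "p dvd x$4 * e" using dvd_add[OF all[OF y] dvd_mult2[OF d]] by simp
  then have e: "p dvd e" using p x(2) prime_dvd_multD by blast
  have "2 * ((a * x$4) * (x$1 + b * s * x$i)) = (a * (x$1 * x$4 + x$4 * x$1) + b * (x$i * x$j + x$j * x$i))
      - d * (2 * b * x$i)"
    by (simp add: d_def algebra_simps)
  then have "p dvd 2 * ((a * x$4) * (x$1 + b * s * x$i))"
    using dvd_diff[OF B[OF x(1) x(1)] dvd_mult2[OF d]] by simp
  moreover have "coprime p 2" using odd by simp
  ultimately have "p dvd (a * x$4) * (x$1 + b * s * x$i)" by (simp only: coprime_dvd_mult_right_iff)
  then have xi: "p dvd x$1 + b * s * x$i" using p ax4 prime_dvd_multD by blast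
  have "(a * x$4) * (y$1 + b * s * y$i) = (a * (x$1 * y$4 + x$4 * y$1) + b * (x$i * y$j + x$j * y$i))
      - (d * (b * y$i) + (e * (b * x$i) + (x$1 + b * s * x$i) * (a * y$4)))"
    by (simp add: d_def e_def algebra_simps)
  moreover have "p dvd (a * (x$1 * y$4 + x$4 * y$1) + b * (x$i * y$j + x$j * y$i))
      - (d * (b * y$i) + (e * (b * x$i) + (x$1 + b * s * x$i) * (a * y$4)))"
    by (intro dvd_diff B x y dvd_add[OF dvd_mult2 dvd_add[OF dvd_mult2 dvd_mult2]] d e xi)
  ultimately have "p dvd (a * x$4) * (y$1 + b * s * y$i)" by simp
  then have "p dvd y$1 + b * s * y$i" using p ax4 prime_dvd_multD by blast
  then show "y \<in> lat4 p a b i j s" using e by (simp add: lat4_def e_def)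
qed

lemma self_dual_cases_4:
  assumes p: "prime p" "odd p" and ab: "\<not> p dvd a" "\<not> p dvd b"
    and G: "\<And>i j. [G $ i $ j = hyp4 a b $ i $ j] (mod p)"
    and L: "self_dual p G L"
  shows "\<exists>i j. middle i j \<and> (L \<subseteq> lat4_inf p i \<or> (\<exists>s\<in>{0..<p}. L \<subseteq> lat4 p a b i j s))"
proof -
  have m: "middle 2 3" "middle 3 2" by (simp_all add: middle_def)
  have B: "p dvd a * (x$1 * y$4 + x$4 * y$1) + b * (x$2 * y$3 + x$3 * y$2)"
    if "x \<in> L" "y \<in> L" for x y
    using self_dual_dvd[OF L that] by (simp only: dvd_bilin_hyp4_iff[OF G m(1)])
  have B': "p dvd a * (x$1 * y$4 + x$4 * y$1) + b * (x$3 * y$2 + x$2 * y$3)"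
    if "x \<in> L" "y \<in> L" for x y
    using self_dual_dvd[OF L that] by (simp only: dvd_bilin_hyp4_iff[OF G m(2)])
  have cop2: "coprime p 2" using p(2) by simp
  \<comment> \<open>Among the vectors with vanishing last coordinate, the form reduces to the product of the
    two middle coordinates, so one of them vanishes throughout.\<close>
  have mid: "(\<forall>y\<in>M. p dvd y$2) \<or> (\<forall>y\<in>M. p dvd y$3)"
    if M: "M \<subseteq> L" "\<forall>y\<in>M. p dvd y$4" for M
  proof (rule ccontr)
    assume "\<not> ?thesis"
    then obtain y z where y: "y \<in> M" "\<not> p dvd y$2" and z: "z \<in> M" "\<not> p dvd z$3" by blast
    have b: "p dvd x$2 * w$3 + x$3 * w$2" if "x \<in> M" "w \<in> M" for x w
    proof -
      have "p dvd a * (x$1 * w$4 + x$4 * w$1)" using M(2) that by simp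
      then have "p dvd b * (x$2 * w$3 + x$3 * w$2)"
        using B[of x w] that M(1) by (simp only: dvd_add_right_iff subsetD)
      then show ?thesis using p(1) ab(2) prime_dvd_multD by blast
    qed
    have "p dvd 2 * (y$2 * y$3)" using b[OF y(1) y(1)] by (simp add: mult.commute)
    then have "p dvd y$2 * y$3" by (simp only: coprime_dvd_mult_right_iff cop2)
    then have y3: "p dvd y$3" using p(1) y(2) prime_dvd_multD by blast
    have "p dvd y$3 * z$2" using y3 by simp
    then have "p dvd y$2 * z$3" using b[OF y(1) z(1)] by (simp only: dvd_add_left_iff)
    then show False using p(1) y(2) z(2) prime_dvd_multD by blast
  qed
  show ?thesis
  proof (cases "\<forall>x\<in>L. p dvd x$4")
    case True
    then have "L \<subseteq> lat4_inf p 2 \<or> L \<subseteq> lat4_inf p 3"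
      using mid[OF subset_refl True] by (auto simp: lat4_inf_def)
    then show ?thesis using m by blast
  next
    case False
    then obtain x where x: "x \<in> L" "\<not> p dvd x$4" by blast
    have "\<not> p dvd a * x$4" using p(1) ab(1) x(2) prime_dvd_multD by blast
    then have "coprime p (a * x$4)" by (rule prime_imp_coprime[OF p(1)])
    then have cop: "coprime (a * x$4) p" by (simp only: coprime_commute)
    have *: "\<exists>s. p dvd x$j - a * s * x$4" for j
    proof -
      obtain s where "p dvd - (x$j) + (a * x$4) * s" using linear_congruence[OF cop] .
      then have "p dvd - (- (x$j) + (a * x$4) * s)" by (simp only: dvd_minus_iff)
      then show ?thesis by (intro exI[of _ s]) (simp add: algebra_simps)
    qed
    obtain s where s: "p dvd x$3 - a * s * x$4" using * by blast
    obtain r where r: "p dvd x$2 - a * r * x$4" using * by blast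
    \<comment> \<open>Eliminating the fourth coordinate with \<open>x\<close> keeps vectors in
      \<open>L\<close> and makes \<open>mid\<close> applicable. Vanishing of coordinate
      \<open>j\<close> of \<open>f y\<close> is the proportionality that
      \<open>self_dual_subset_lat4\<close> asks for.\<close>
    define f where "f y = x$4 *s y + (- (y$4)) *s x" for y
    have fL: "f ` L \<subseteq> L"
      unfolding f_def by (intro image_subsetI self_dual_add[OF L] self_dual_scale[OF L] x(1))
    have f4: "\<forall>y\<in>f ` L. p dvd y$4" by (simp add: f_def)
    show ?thesis using mid[OF fL f4]
    proof
      assume "\<forall>y\<in>f ` L. p dvd y$2"
      then have "p dvd x$4 * y$2 - y$4 * x$2" if "y \<in> L" for y using that by (simp add: f_def)
      then have "L \<subseteq> lat4 p a b 3 2 r"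
        by (intro self_dual_subset_lat4[OF p(1) ab B' p(2) x r])
      also have "\<dots> \<subseteq> lat4 p a b 3 2 (r mod p)" by (rule lat4_cong) (simp add: cong_def)
      finally have "L \<subseteq> lat4 p a b 3 2 (r mod p)" .
      moreover have "r mod p \<in> {0..<p}" using prime_gt_0_int[OF p(1)] by simp
      ultimately show ?thesis using m by blast
    next
      assume "\<forall>y\<in>f ` L. p dvd y$3"
      then have "p dvd x$4 * y$3 - y$4 * x$3" if "y \<in> L" for y using that by (simp add: f_def)
      then have "L \<subseteq> lat4 p a b 2 3 s"
        by (intro self_dual_subset_lat4[OF p(1) ab B p(2) x s])
      also have "\<dots> \<subseteq> lat4 p a b 2 3 (s mod p)" by (rule lat4_cong) (simp add: cong_def)
      finally have "L \<subseteq> lat4 p a b 2 3 (s mod p)" .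
      moreover have "s mod p \<in> {0..<p}" using prime_gt_0_int[OF p(1)] by simp
      ultimately show ?thesis using m by blast
    qed
  qed
qed

lemma sublattices_4:
  fixes G :: "int^4^4"
  assumes p: "prime p" "odd p" and ab: "\<not> p dvd a" "\<not> p dvd b"
    and G: "\<And>i j. [G $ i $ j = hyp4 a b $ i $ j] (mod p)"
    and GI: "integral_form G" "\<not> p dvd det G"
  shows "sublattices p G = lat4 p a b 2 3 ` {0..<p} \<union> lat4 p a b 3 2 ` {0..<p}
      \<union> {lat4_inf p 2, lat4_inf p 3}" (is "_ = ?R")
proof -
  have sd: "self_dual p G L" if "L \<in> sublattices p G" for L
  proof (rule sublattice_self_dual[OF that])
    show "transpose G = G" using GI(1) by (simp add: integral_form_def)
    show "det G \<noteq> 0" using GI(2) by auto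
    show "coprime p (det G)" by (rule prime_imp_coprime[OF p(1) GI(2)])
    show "p \<noteq> 0" using p(1) by auto
  qed
  have mem: "lat4_inf p i \<in> sublattices p G" "lat4 p a b i j s \<in> sublattices p G"
    if "middle i j" for i j s
    by (rule lat4_inf_mem_sublattices[OF G that]) (rule lat4_mem_sublattices[OF G that])
  have R: "lat4_inf p i \<in> ?R" "\<And>s. s \<in> {0..<p} \<Longrightarrow> lat4 p a b i j s \<in> ?R" if "middle i j" for i j
    using that by (auto simp: middle_def)
  show ?thesis
  proof (intro equalityI subsetI)
    fix L assume "L \<in> sublattices p G"
    then have L: "self_dual p G L" by (rule sd)
    obtain i j where ij: "middle i j"
      and or: "L \<subseteq> lat4_inf p i \<or> (\<exists>s\<in>{0..<p}. L \<subseteq> lat4 p a b i j s)"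
      using self_dual_cases_4[OF p ab G L] by (elim exE conjE)
    from or show "L \<in> ?R"
    proof (elim disjE bexE)
      assume "L \<subseteq> lat4_inf p i"
      then have "L = lat4_inf p i" by (rule self_dual_subset_eq[OF L sd[OF mem(1)[OF ij]]])
      then show ?thesis using R(1)[OF ij] by (simp only:)
    next
      fix s assume s: "s \<in> {0..<p}" "L \<subseteq> lat4 p a b i j s"
      have "L = lat4 p a b i j s" by (rule self_dual_subset_eq[OF L sd[OF mem(2)[OF ij]] s(2)])
      then show ?thesis using R(2)[OF ij s(1)] by (simp only:)
    qed
  next
    have "middle 2 3" "middle 3 2" by (simp_all add: middle_def)
    then show "L \<in> sublattices p G" if "L \<in> ?R" for L
      using that mem[of 2 3] mem[of 3 2] by auto
  qed
qed

lemma inj_on_lat4: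
  assumes p: "prime p" and a: "\<not> p dvd a" and ij: "middle i j"
  shows "inj_on (lat4 p a b i j) {0..<p}"
proof (rule inj_onI)
  fix s t assume st: "s \<in> {0..<p}" "t \<in> {0..<p}" and eq: "lat4 p a b i j s = lat4 p a b i j t"
  \<comment> \<open>A vector of the lattice whose fourth coordinate \<open>1\<close> lets coordinate
    \<open>j\<close> reveal \<open>a s\<close> modulo \<open>p\<close>.\<close>
  define v :: "int^4" where "v = (\<chi> k. if k = j then a * s else if k = 4 then 1 else 0)"
  have "v \<in> lat4 p a b i j s" using middle_neq[OF ij] by (auto simp: v_def lat4_def)
  then have "v \<in> lat4 p a b i j t" by (simp only: eq)
  then have "p dvd a * (s - t)"
    using middle_neq[OF ij] by (auto simp: v_def lat4_def algebra_simps)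
  then have "p dvd s - t" using p a prime_dvd_multD by blast
  then show "s = t" using eq_if_cong_range[OF _ st] by (simp add: cong_iff_dvd_diff)
qed

text \<open>Each ruling has \<open>p\<close> finite members and one at infinity. A fourth coordinate
  \<open>1\<close> separates finite from infinite, and \<open>(- b s, 1, 0, 0)\<close> separates the
  finite members of the two rulings.\<close>

lemma card_lat4:
  assumes p: "prime p" and a: "\<not> p dvd a"
  shows "card (lat4 p a b 2 3 ` {0..<p} \<union> lat4 p a b 3 2 ` {0..<p} \<union> {lat4_inf p 2, lat4_inf p 3})
    = 2 * (nat p + 1)"
proof -
  have m: "middle 2 3" "middle 3 2" by (simp_all add: middle_def)
  have unit: "\<not> p dvd 1" using p not_prime_unit by blast
  have ne1: "lat4 p a b 2 3 s \<noteq> lat4 p a b 3 2 t" for s t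
  proof
    assume eq: "lat4 p a b 2 3 s = lat4 p a b 3 2 t"
    have "vector [- b * s, 1, 0, 0] \<in> lat4 p a b 2 3 s" by (simp add: lat4_def)
    then have "vector [- b * s, 1, 0, 0] \<in> lat4 p a b 3 2 t" by (simp only: eq)
    then show False using unit by (simp add: lat4_def)
  qed
  have ne2: "lat4_inf p k \<noteq> lat4 p a b i j s" if "middle i j" for i j k s
  proof
    assume eq: "lat4_inf p k = lat4 p a b i j s"
    define v :: "int^4" where "v = (\<chi> k. if k = j then a * s else if k = 4 then 1 else 0)"
    have "v \<in> lat4 p a b i j s" using middle_neq[OF that] by (auto simp: v_def lat4_def)
    then have "v \<in> lat4_inf p k" by (simp only: eq)
    then show False using unit middle_neq[OF that] by (auto simp: v_def lat4_inf_def)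
  qed
  have ne3: "lat4_inf p 2 \<noteq> lat4_inf p 3"
  proof
    assume eq: "lat4_inf p 2 = lat4_inf p 3"
    have "axis 3 1 \<in> lat4_inf p 2" by (simp add: lat4_inf_def axis_def)
    then have "axis 3 1 \<in> lat4_inf p 3" by (simp only: eq)
    then show False using unit by (simp add: lat4_inf_def axis_def)
  qed
  let ?A = "lat4 p a b 2 3 ` {0..<p}" and ?B = "lat4 p a b 3 2 ` {0..<p}"
    and ?C = "{lat4_inf p 2, lat4_inf p 3}"
  have card: "card ?A = nat p" "card ?B = nat p" "card ?C = 2"
    using ne3 by (simp_all add: card_image[OF inj_on_lat4[OF p a]] m)
  have "?A \<inter> ?B = {}" using ne1 by auto
  then have "card (?A \<union> ?B) = nat p + nat p"
    by (simp only: card_Un_disjoint finite_imageI finite_atLeastLessThan_int card)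
  moreover have "(?A \<union> ?B) \<inter> ?C = {}" using ne2[OF m(1)] ne2[OF m(2)] by auto
  ultimately show ?thesis
    using card_Un_disjoint[of "?A \<union> ?B" ?C] card(3) by simp
qed

lemma card_sublattices_4:
  fixes N :: "int^4^4"
  assumes p: "prime p" "odd p" and N: "integral_form N" "\<not> p dvd det N" "[det N = d\<^sup>2] (mod p)"
  shows "card (sublattices p N) = 2 * (nat p + 1)" and "finite (sublattices p N)"
proof -
  obtain G a b where G: "int_equivalent N G" and ab: "\<not> p dvd a" "\<not> p dvd b"
    and c: "\<And>i j. [G $ i $ j = hyp4 a b $ i $ j] (mod p)"
    using quaternary_normal_form[OF p N] by metis
  have "integral_form G" "\<not> p dvd det G"
    using int_equivalent_integral_form[OF G N(1)] int_equivalent_det[OF G] N(2) by simp_all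
  note eq = sublattices_4[OF p ab c this]
  obtain f where f: "bij_betw f (sublattices p G) (sublattices p N)"
    "\<forall>q L. primitive_at q (f L) \<longleftrightarrow> primitive_at q L"
    using sublattices_equivalent[OF G, of p] .
  show "card (sublattices p N) = 2 * (nat p + 1)"
    using bij_betw_same_card[OF f(1)] card_lat4[OF p(1) ab(1)] by (simp only: eq)
  then show "finite (sublattices p N)" by (intro card_ge_0_finite) simp
qed

text \<open>A polynomial identity in the six coefficients of the ternary form, with
  \<open>\<Delta>\<close> its half-discriminant. It is the source of the square that makes the
  quadric split.\<close>

lemma det_clifford_norm_form:
  assumes "integral_form Q" "det Q = 2 * \<Delta>"
  shows "det (clifford_norm_form Q) = \<Delta>\<^sup>2"
proof -
  define a b c where "a = Q$1$1 div 2" and "b = Q$2$2 div 2" and "c = Q$3$3 div 2"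
  define u v w where "u = Q$1$2" and "v = Q$1$3" and "w = Q$2$3"
  have even: "2 * (Q $ i $ i div 2) = Q $ i $ i" for i
    using assms(1) by (simp add: integral_form_def)
  have diag: "Q$1$1 = 2 * a" "Q$2$2 = 2 * b" "Q$3$3 = 2 * c"
    unfolding a_def b_def c_def by (simp_all only: even)
  have off: "Q$1$2 = u" "Q$1$3 = v" "Q$2$3 = w" "Q$2$1 = u" "Q$3$1 = v" "Q$3$2 = w"
    using integral_form_sym[OF assms(1)] by (simp_all add: u_def v_def w_def)
  have "2 * \<Delta> = 2 * (4 * a * b * c + u * v * w - a * w\<^sup>2 - b * v\<^sup>2 - c * u\<^sup>2)"
    unfolding assms(2)[symmetric] det_3 diag off by (simp add: power2_eq_square algebra_simps)
  then have \<Delta>: "\<Delta> = 4 * a * b * c + u * v * w - a * w\<^sup>2 - b * v\<^sup>2 - c * u\<^sup>2" by simp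
  have N: "clifford_norm_form Q = vector
     [vector [2, w, - v, u],
      vector [w, 2 * (b * c), - (u * c), u * w - v * b],
      vector [- v, - (u * c), 2 * (a * c), - (a * w)],
      vector [u, u * w - v * b, - (a * w), 2 * (a * b)]]"
    by (simp add: clifford_norm_form_def Let_def upper_matrix_def adjugate_upper
        a_def b_def c_def u_def v_def w_def transpose_def vec_eq_iff forall_4)
  show ?thesis unfolding N \<Delta>
    by (simp add: det_4 power2_eq_square algebra_simps)
qed

section \<open>Primitive matrices and primitive lattices\<close>

lemma dvd_Gcd_entries_iff: "d dvd Gcd {A $ i $ j |i j. True} \<longleftrightarrow> (\<forall>i j. d dvd A $ i $ j)"
  for A :: "int^'n^'m"
  by (auto simp: dvd_Gcd_iff)

text \<open>The gcd is nonnegative, so it is \<open>1\<close> as soon as it is a unit.\<close>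

lemma Gcd_entries_eq_1_iff:
  "Gcd {A $ i $ j |i j. True} = 1 \<longleftrightarrow> (\<forall>d. (\<forall>i j. d dvd A $ i $ j) \<longrightarrow> d dvd 1)"
  for A :: "int^'n^'m"
proof -
  have "Gcd {A $ i $ j |i j. True} = 1 \<longleftrightarrow> Gcd {A $ i $ j |i j. True} dvd 1"
    using Gcd_int_greater_eq_0[of "{A $ i $ j |i j. True}"] by (simp only: zdvd1_eq abs_of_nonneg)
  also have "\<dots> \<longleftrightarrow> (\<forall>d. d dvd Gcd {A $ i $ j |i j. True} \<longrightarrow> d dvd 1)"
    by (meson dvd_refl dvd_trans)
  finally show ?thesis by (simp only: dvd_Gcd_entries_iff)
qed

lemma dvd_matrix_mult: "(\<And>i j. d dvd A $ i $ j) \<Longrightarrow> d dvd (A ** B) $ i $ j"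
  for A :: "int^'n^'m"
  by (simp add: matrix_matrix_mult_def dvd_sum)

lemma Gcd_entries_mult_invertible:
  fixes A :: "int^'m^'m"
  assumes "Gcd {A $ i $ j |i j. True} = 1" "invertible U"
  shows "Gcd {(A ** U) $ i $ j |i j. True} = 1"
  unfolding Gcd_entries_eq_1_iff
proof (intro allI impI)
  fix d assume d: "\<forall>i j. d dvd (A ** U) $ i $ j"
  obtain V where V: "U ** V = mat 1" using assms(2) unfolding invertible_def by (elim exE conjE)
  have A: "A = (A ** U) ** V" by (simp flip: matrix_mul_assoc add: V)
  have "d dvd A $ i $ j" for i j by (subst A) (rule dvd_matrix_mult, simp add: d)
  then show "d dvd 1" using assms(1) unfolding Gcd_entries_eq_1_iff by blast
qed

text \<open>A common divisor of the entries divides the determinant, whose square is a power of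
  \<open>p\<close>; so \<open>p\<close> is the only prime that can divide all entries.\<close>

lemma Gcd_entries_eq_1_iff_primitive:
  fixes A :: "int^'m^'m"
  assumes p: "prime p" and "(det A)\<^sup>2 = (p\<^sup>2) ^ CARD('m)"
  shows "Gcd {A $ i $ j |i j. True} = 1 \<longleftrightarrow> primitive_at p (range ((*v) A))"
proof -
  have prim: "primitive_at p (range ((*v) A)) \<longleftrightarrow> \<not> (\<forall>i j. p dvd A $ i $ j)"
  proof
    assume "primitive_at p (range ((*v) A))"
    then obtain y i where yi: "\<not> p dvd (A *v y) $ i" unfolding primitive_at_def by blast
    show "\<not> (\<forall>i j. p dvd A $ i $ j)"
    proof
      assume "\<forall>i j. p dvd A $ i $ j"
      then have "p dvd (A *v y) $ i" by (simp add: matrix_vector_mult_def dvd_sum)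
      then show False using yi by contradiction
    qed
  next
    assume "\<not> (\<forall>i j. p dvd A $ i $ j)"
    then obtain i j where "\<not> p dvd A $ i $ j" by blast
    then have "\<not> p dvd (A *v axis j 1) $ i" by (simp add: mult_axis column_def)
    then show "primitive_at p (range ((*v) A))" unfolding primitive_at_def by blast
  qed
  have p1: "\<not> p dvd 1" using p not_prime_unit by blast
  have "d dvd 1" if d: "\<forall>i j. d dvd A $ i $ j" and n: "\<not> (\<forall>i j. p dvd A $ i $ j)" for d
  proof (rule ccontr)
    assume nu: "\<not> d dvd 1"
    \<comment> \<open>Any row will do; \<open>undefined\<close> names one.\<close>
    have "d dvd det A" using d by (intro dvd_det_row[of d A undefined]) blast
    then have "d dvd (det A)\<^sup>2" by (simp add: power2_eq_square)
    then have dd: "d dvd (p\<^sup>2) ^ CARD('m)" by (simp only: assms(2))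
    have "p \<noteq> 0" using p by auto
    then have "d \<noteq> 0" using dd by auto
    then obtain q where q: "prime q" "q dvd d" using nu prime_divisor_exists[of d] by blast
    have "q dvd (p\<^sup>2) ^ CARD('m)" using q(2) dd by (rule dvd_trans)
    then have "q dvd p" using q(1) prime_dvd_power by blast
    then have "q = p" using q(1) p primes_dvd_imp_eq by blast
    then have pd: "p dvd d" using q(2) by simp
    have "p dvd A $ i $ j" for i j using pd by (rule dvd_trans) (simp add: d)
    then show False using n by simp
  qed
  then show ?thesis unfolding prim Gcd_entries_eq_1_iff using p1 by blast
qed

theorem theorem6p3:
  fixes Q :: "int^3^3" and N :: "int^4^4" and \<Delta> :: int and p h H :: nat
    and q :: "nat \<Rightarrow> int^3^3" and n :: "nat \<Rightarrow> int^4^4"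
  assumes "integral_form Q" and "det Q \<noteq> 0" and "det Q = 2 * \<Delta>"
    and "prime p" and "\<not> int p dvd 2 * \<Delta>"
    and "N = clifford_norm_form Q"
    and "complete_system (similarity_class Q) h q"
    and "complete_system (similarity_class N) H n"
  shows "real (\<Sum>i=1..h. card (cosets_mod_automorphs
             (prim_reps Q (scale_form ((int p)\<^sup>2) (q i))) (q i)))
         = inverse (1 + real_of_int (Legendre ((- 1)\<^sup>2 * \<Delta>\<^sup>2) (int p)))
           * real (\<Sum>i=1..H. card (cosets_mod_automorphs
             (reps N (scale_form (int p) (n i))) (n i)))"
proof -
  have p: "prime (int p)" using assms(4) by simp
  have "p \<noteq> 2" using assms(5) by auto
  then have odd: "odd (int p)" using assms(4) prime_odd_nat[of p] prime_ge_2_nat[of p] by simp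
  have pQ: "\<not> int p dvd det Q" using assms(3,5) by simp
  have p\<Delta>: "\<not> int p dvd \<Delta>" using assms(5) by auto
  have detN: "det N = \<Delta>\<^sup>2" unfolding assms(6) by (rule det_clifford_norm_form[OF assms(1,3)])
  have pN: "\<not> int p dvd det N"
    unfolding detN power2_eq_square using p p\<Delta> prime_dvd_multD by blast
  have N: "integral_form N" unfolding assms(6) by (rule integral_form_clifford_norm_form)

  define T where "T = {A :: int^3^3. Gcd {A $ i $ j |i j. True} = 1}"
  have "(\<Sum>i=1..h. card (cosets_mod_automorphs (reps Q (scale_form ((int p)\<^sup>2) (q i)) \<inter> T) (q i)))
      = card {L \<in> sublattices ((int p)\<^sup>2) Q. primitive_at (int p) L}"
  proof (rule sum_card_cosets[OF assms(7,1,2)])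
    show "coprime ((int p)\<^sup>2) (det Q)"
      unfolding coprime_power_left_iff by (intro disjI1 prime_imp_coprime[OF p pQ])
    show "odd ((int p)\<^sup>2)" using odd by simp
    show "A ** U \<in> T" if "A \<in> T" "invertible U" for A U
      using Gcd_entries_mult_invertible[OF _ that(2)] that(1) by (simp add: T_def)
    show "finite {L \<in> sublattices ((int p)\<^sup>2) Q. primitive_at (int p) L}"
      by (rule card_primitive_sublattices_3(2)[OF p odd assms(1) pQ])
    have "A \<in> T \<longleftrightarrow> primitive_at (int p) (range ((*v) A))"
      if "(det A)\<^sup>2 = ((int p)\<^sup>2) ^ CARD(3)" for A
      unfolding T_def mem_Collect_eq by (rule Gcd_entries_eq_1_iff_primitive[OF p that])
    then show "{L \<in> sublattices ((int p)\<^sup>2) Q. primitive_at (int p) L}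
        = {range ((*v) A) |A. A \<in> T \<and> (det A)\<^sup>2 = ((int p)\<^sup>2) ^ CARD(3)
          \<and> (\<forall>i j. (int p)\<^sup>2 dvd (transpose A ** Q ** A) $ i $ j)}"
      unfolding sublattices_def by blast
  qed
  moreover have "prim_reps Q F = reps Q F \<inter> T" for F
    unfolding prim_reps_def T_def by blast
  ultimately have lhs: "(\<Sum>i=1..h. card (cosets_mod_automorphs
      (prim_reps Q (scale_form ((int p)\<^sup>2) (q i))) (q i))) = p + 1"
    using card_primitive_sublattices_3(1)[OF p odd assms(1) pQ] by simp

  have "(\<Sum>i=1..H. card (cosets_mod_automorphs (reps N (scale_form (int p) (n i)) \<inter> UNIV) (n i)))
      = card (sublattices (int p) N)"
  proof (rule sum_card_cosets[OF assms(8) N])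
    show "det N \<noteq> 0" using pN by auto
    show "coprime (int p) (det N)" by (rule prime_imp_coprime[OF p pN])
    show "finite (sublattices (int p) N)"
      by (rule card_sublattices_4(2)[OF p odd N pN, of \<Delta>]) (simp add: detN)
    show "sublattices (int p) N = {range ((*v) A) |A. A \<in> UNIV \<and> (det A)\<^sup>2 = (int p) ^ CARD(4)
          \<and> (\<forall>i j. int p dvd (transpose A ** N ** A) $ i $ j)}"
      unfolding sublattices_def by simp
  qed (use odd in simp_all)
  also have "card (sublattices (int p) N) = 2 * (p + 1)"
    using card_sublattices_4(1)[OF p odd N pN, of \<Delta>] by (simp add: detN)
  finally have rhs: "(\<Sum>i=1..H. card (cosets_mod_automorphs
      (reps N (scale_form (int p) (n i))) (n i))) = 2 * (p + 1)" by simp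

  \<comment> \<open>\<open>\<Delta>\<close> is a square root and a unit modulo \<open>p\<close>, so
    the symbol is \<open>1\<close> and the prefactor \<open>1/2\<close> turns
    \<open>2 * (p + 1)\<close> into \<open>p + 1\<close>.\<close>
  have "QuadRes (int p) ((- 1)\<^sup>2 * \<Delta>\<^sup>2)" unfolding QuadRes_def by (intro exI[of _ \<Delta>]) simp
  moreover have "\<not> [(- 1)\<^sup>2 * \<Delta>\<^sup>2 = 0] (mod int p)"
    using pN by (simp add: detN cong_0_iff)
  ultimately have "Legendre ((- 1)\<^sup>2 * \<Delta>\<^sup>2) (int p) = 1" by (simp add: Legendre_def)
  then show ?thesis unfolding lhs rhs by simp
qed

end
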